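(* Let $(X,\mathcal B,m)$ be a measure space with $m$ localizable and let $E$ be a closed quadratic form on $L^0(m)$. The following assertions are equivalent. (i) $E$ is an energy form. (ii) For every normal contraction $C:\mathbb R\to\mathbb R$ and every $f\in L^0(m)$, $E(C\circ f)\le E(f)$. (iii) For every $n\in\mathbb N$, every normal contraction $C:\mathbb R^n\to\mathbb R$ and all $f_1,\dots,f_n\in L^0(m)$, $E(C(f_1,\dots,f_n))^{1/2}\le\sum_{k=1}^nE(f_k)^{1/2}$. (iv) For every $n\in\mathbb N$ and all $f,f_1,\dots,f_n\in L^0(m)$, the inequalities $|f(x)|\le\sum_{k=1}^n|f_k(x)|$ and $|f(x)-f(y)|\le\sum_{k=1}^n|f_k(x)-f_k(y)|$ for $m$-a.e. $x,y\in X$ imply $E(f)^{1/2}\le\sum_{k=1}^nE(f_k)^{1/2}$.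
   Context: A measure $m$ is localizable if it is semi-finite and every family $\mathcal A\subseteq\mathcal B$ has an essential supremum $S\in\mathcal B$, i.e. $m(A\setminus S)=0$ for all $A\in\mathcal A$, and $m(S\setminus G)=0$ whenever $G\in\mathcal B$ satisfies $m(A\setminus G)=0$ for all $A\in\mathcal A$. $L^0(m)$ is the space of real-valued measurable functions modulo $m$-a.e. equality, with the topology $\tau(m)$ of local convergence in measure: $f_i\to f$ iff $\int_U|f_i-f|\wedge1\,dm\to0$ for every measurable $U$ with $m(U)<\infty$. A quadratic form on $L^0(m)$ is a map $q:L^0(m)\to[0,\infty]$ with $2q(u)+2q(v)=q(u+v)+q(u-v)$ and $q(\lambda u)=|\lambda|^2q(u)$ ($0\cdot\infty=0$), $D(q)=\{q<\infty\}$. It is closed if $D(q)$ is complete in the form topology, the smallest topology containing the subspace topology of $\tau(m)$ and the topology of the seminorm $q^{1/2}$. A normal contraction is a map $C:\mathbb R^n\to\mathbb R$ with $C(0)=0$ and $|C(x)-C(y)|\le\sum_{i=1}^n|x_i-y_i|$. An $\varepsilon$-cutoff is a monotone increasing normal contraction $C:\mathbb R\to[-\varepsilon,1+\varepsilon]$ with $C(x)=x$ for $x\in[0,1]$. A quadratic form $E$ on $L^0(m)$ is Markovian if for each $\varepsilon>0$ there is an $\varepsilon$-cutoff $C_\varepsilon$ with $E(C_\varepsilon\circ f)\le E(f)$ for all $f\in L^0(m)$; an energy form is a closed Markovian form on $L^0(m)$. In (iv), "for $m$-a.e. $x,y\in X$" means that there are measurable representatives of $f,f_1,\dots,f_n$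 for which the inequalities hold for all $x,y\in X$. *)

theory Defs
  imports "HOL-Analysis.Analysis"
begin

section \<open>Localizable measures\<close>

definition essential_supremum :: "'a measure \<Rightarrow> 'a set set \<Rightarrow> 'a set \<Rightarrow> bool" where
  "essential_supremum M \<A> S \<longleftrightarrow>
     S \<in> sets M \<and>
     (\<forall>A\<in>\<A>. emeasure M (A - S) = 0) \<and>
     (\<forall>G\<in>sets M. (\<forall>A\<in>\<A>. emeasure M (A - G) = 0) \<longrightarrow> emeasure M (S - G) = 0)"

text \<open>
  The locale \<open>semifinite_measure\<close> of \<open>HOL-Analysis.Complete_Measure\<close> does not require \<open>B\<close> to have
  positive measure and holds for every measure.
\<close>

definition semifinite :: "'a measure \<Rightarrow> bool" where
  "semifinite M \<longleftrightarrow>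
     (\<forall>A\<in>sets M. emeasure M A = \<infinity> \<longrightarrow>
        (\<exists>B\<in>sets M. B \<subseteq> A \<and> 0 < emeasure M B \<and> emeasure M B < \<infinity>))"

definition localizable :: "'a measure \<Rightarrow> bool" where
  "localizable M \<longleftrightarrow>
     semifinite M \<and> (\<forall>\<A>\<subseteq>sets M. \<exists>S. essential_supremum M \<A> S)"


section \<open>The space L0\<close>

definition L0_rel :: "'a measure \<Rightarrow> ('a \<Rightarrow> real) rel" where
  "L0_rel M = {(f, g). f \<in> borel_measurable M \<and> g \<in> borel_measurable M \<and> (AE x in M. f x = g x)}"

definition L0 :: "'a measure \<Rightarrow> ('a \<Rightarrow> real) set set" where
  "L0 M = borel_measurable M // L0_rel M"

definition L0_class :: "'a measure \<Rightarrow> ('a \<Rightarrow> real) \<Rightarrow> ('a \<Rightarrow> real) set" where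
  "L0_class M f = L0_rel M `` {f}"

text \<open>
  Operations on classes are unions over all representatives; since all representatives yield the
  same class, these unions are over constant families. For \<open>L0_map\<close> and \<open>L0_map_n\<close> this presupposes
  that \<open>C\<close> preserves measurability, which is the case for the maps they are applied to. The
  argument of \<open>C\<close> in \<open>L0_map_n\<close> is padded with \<open>0\<close> beyond the first \<open>n\<close> coordinates.
\<close>

definition L0_map :: "'a measure \<Rightarrow> (real \<Rightarrow> real) \<Rightarrow> ('a \<Rightarrow> real) set \<Rightarrow> ('a \<Rightarrow> real) set" where
  "L0_map M C u = (\<Union>f\<in>u. L0_class M (\<lambda>x. C (f x)))"

definition L0_map_n ::
  "'a measure \<Rightarrow> nat \<Rightarrow> ((nat \<Rightarrow> real) \<Rightarrow> real) \<Rightarrow> (nat \<Rightarrow> ('a \<Rightarrow> real) set) \<Rightarrow> ('a \<Rightarrow> real) set" where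
  "L0_map_n M n C us =
     (\<Union>f\<in>Pi {..<n} us. L0_class M (\<lambda>x. C (\<lambda>k. if k < n then f k x else 0)))"

definition L0_add :: "'a measure \<Rightarrow> ('a \<Rightarrow> real) set \<Rightarrow> ('a \<Rightarrow> real) set \<Rightarrow> ('a \<Rightarrow> real) set" where
  "L0_add M u v = (\<Union>f\<in>u. \<Union>g\<in>v. L0_class M (\<lambda>x. f x + g x))"

definition L0_diff :: "'a measure \<Rightarrow> ('a \<Rightarrow> real) set \<Rightarrow> ('a \<Rightarrow> real) set \<Rightarrow> ('a \<Rightarrow> real) set" where
  "L0_diff M u v = (\<Union>f\<in>u. \<Union>g\<in>v. L0_class M (\<lambda>x. f x - g x))"

definition L0_scale :: "'a measure \<Rightarrow> real \<Rightarrow> ('a \<Rightarrow> real) set \<Rightarrow> ('a \<Rightarrow> real) set" where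
  "L0_scale M c u = (\<Union>f\<in>u. L0_class M (\<lambda>x. c * f x))"

definition L0_zero :: "'a measure \<Rightarrow> ('a \<Rightarrow> real) set" where
  "L0_zero M = L0_class M (\<lambda>x. 0)"

lemma equiv_L0_rel: "equiv (borel_measurable M) (L0_rel M)"
proof (rule equivI)
  show "L0_rel M \<subseteq> borel_measurable M \<times> borel_measurable M"
    by (auto simp: L0_rel_def)
  show "refl_on (borel_measurable M) (L0_rel M)"
    by (auto simp: refl_on_def L0_rel_def)
  show "sym (L0_rel M)"
    by (auto simp: sym_def L0_rel_def eq_commute)
  show "trans (L0_rel M)"
    unfolding trans_def
  proof safe
    fix f g h :: "'a \<Rightarrow> real"
    assume "(f, g) \<in> L0_rel M" "(g, h) \<in> L0_rel M"
    then have "AE x in M. f x = g x" "AE x in M. g x = h x"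
      "f \<in> borel_measurable M" "h \<in> borel_measurable M"
      by (auto simp: L0_rel_def)
    moreover from this(1,2) have "AE x in M. f x = h x" by eventually_elim simp
    ultimately show "(f, h) \<in> L0_rel M" by (simp add: L0_rel_def)
  qed
qed

lemma L0_class_eqI:
  "\<lbrakk>f \<in> borel_measurable M; g \<in> borel_measurable M; AE x in M. f x = g x\<rbrakk>
   \<Longrightarrow> L0_class M f = L0_class M g"
  unfolding L0_class_def by (rule equiv_class_eq[OF equiv_L0_rel]) (simp add: L0_rel_def)

lemma L0_class_mem: "f \<in> borel_measurable M \<Longrightarrow> L0_class M f \<in> L0 M"
  by (simp add: L0_class_def L0_def quotientI)

lemma L0_class_self: "f \<in> borel_measurable M \<Longrightarrow> f \<in> L0_class M f"
  by (simp add: L0_class_def L0_rel_def)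

lemma L0_classD:
  "g \<in> L0_class M f \<Longrightarrow>
   f \<in> borel_measurable M \<and> g \<in> borel_measurable M \<and> (AE x in M. f x = g x)"
  by (auto simp: L0_class_def L0_rel_def)

lemma L0_add_class:
  assumes "f \<in> borel_measurable M" "g \<in> borel_measurable M"
  shows "L0_add M (L0_class M f) (L0_class M g) = L0_class M (\<lambda>x. f x + g x)"
proof -
  have "L0_class M (\<lambda>x. f' x + g' x) = L0_class M (\<lambda>x. f x + g x)"
    if "f' \<in> L0_class M f" "g' \<in> L0_class M g" for f' g'
  proof (rule L0_class_eqI)
    from that[THEN L0_classD] have "AE x in M. f x = f' x" "AE x in M. g x = g' x" by auto
    then show "AE x in M. f' x + g' x = f x + g x" by eventually_elim simp
  qed (use that[THEN L0_classD] in auto)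
  then show ?thesis
    unfolding L0_add_def
    by (intro UN_constant_eq[OF L0_class_self[OF assms(1)]] UN_constant_eq[OF L0_class_self[OF assms(2)]] ballI)
qed

lemma L0_diff_class:
  assumes "f \<in> borel_measurable M" "g \<in> borel_measurable M"
  shows "L0_diff M (L0_class M f) (L0_class M g) = L0_class M (\<lambda>x. f x - g x)"
proof -
  have "L0_class M (\<lambda>x. f' x - g' x) = L0_class M (\<lambda>x. f x - g x)"
    if "f' \<in> L0_class M f" "g' \<in> L0_class M g" for f' g'
  proof (rule L0_class_eqI)
    from that[THEN L0_classD] have "AE x in M. f x = f' x" "AE x in M. g x = g' x" by auto
    then show "AE x in M. f' x - g' x = f x - g x" by eventually_elim simp
  qed (use that[THEN L0_classD] in auto)
  then show ?thesis
    unfolding L0_diff_def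
    by (intro UN_constant_eq[OF L0_class_self[OF assms(1)]] UN_constant_eq[OF L0_class_self[OF assms(2)]] ballI)
qed

lemma L0_map_class:
  assumes "f \<in> borel_measurable M" "C \<in> borel_measurable borel"
  shows "L0_map M C (L0_class M f) = L0_class M (\<lambda>x. C (f x))"
proof -
  have "L0_class M (\<lambda>x. C (f' x)) = L0_class M (\<lambda>x. C (f x))"
    if "f' \<in> L0_class M f" for f'
  proof (rule L0_class_eqI)
    from L0_classD[OF that] have "AE x in M. f x = f' x" by auto
    then show "AE x in M. C (f' x) = C (f x)" by eventually_elim simp
  qed (use L0_classD[OF that] assms in \<open>auto intro: measurable_compose\<close>)
  then show ?thesis
    unfolding L0_map_def by (intro UN_constant_eq[OF L0_class_self[OF assms(1)]] ballI)
qed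

lemma L0_scale_class:
  assumes "f \<in> borel_measurable M"
  shows "L0_scale M c (L0_class M f) = L0_class M (\<lambda>x. c * f x)"
  using L0_map_class[OF assms, of "\<lambda>t. c * t"] by (simp add: L0_scale_def L0_map_def)


section \<open>Local convergence in measure\<close>

text \<open>
  The image below is a singleton, as the integral does not depend on the representative.
\<close>

definition L0_gauge :: "'a measure \<Rightarrow> 'a set \<Rightarrow> ('a \<Rightarrow> real) set \<Rightarrow> ennreal" where
  "L0_gauge M U u = the_elem ((\<lambda>f. \<integral>\<^sup>+x\<in>U. ennreal (min \<bar>f x\<bar> 1) \<partial>M) ` u)"

lemma L0_gauge_class:
  assumes "f \<in> borel_measurable M"
  shows "L0_gauge M U (L0_class M f) = (\<integral>\<^sup>+x\<in>U. ennreal (min \<bar>f x\<bar> 1) \<partial>M)"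
proof -
  have "(\<integral>\<^sup>+x\<in>U. ennreal (min \<bar>g x\<bar> 1) \<partial>M) = (\<integral>\<^sup>+x\<in>U. ennreal (min \<bar>f x\<bar> 1) \<partial>M)"
    if "g \<in> L0_class M f" for g
  proof (rule nn_integral_cong_AE)
    from L0_classD[OF that] have "AE x in M. f x = g x" by auto
    then show "AE x in M. ennreal (min \<bar>g x\<bar> 1) * indicator U x =
                          ennreal (min \<bar>f x\<bar> 1) * indicator U x"
      by eventually_elim simp
  qed
  then show ?thesis
    unfolding L0_gauge_def using L0_class_self[OF assms] by (intro the_elem_image_unique) blast+
qed

text \<open>
  The topology generated by the pseudometrics \<open>(u, v) \<mapsto> \<integral>\<^bsub>U\<^esub> \<bar>u - v\<bar> \<and> 1\<close>, where \<open>U\<close> ranges over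
  the measurable sets of finite measure; its convergent nets are those converging with respect to
  each of them. In general it is not first countable.
\<close>

definition L0_topology :: "'a measure \<Rightarrow> ('a \<Rightarrow> real) set topology" where
  "L0_topology M = topology_generated_by
     {{v \<in> L0 M. L0_gauge M U (L0_diff M v u) < ennreal r} | U u r.
        U \<in> sets M \<and> emeasure M U < \<infinity> \<and> u \<in> L0 M \<and> 0 < r}"


section \<open>Quadratic forms\<close>

definition sqrt_ennreal :: "ennreal \<Rightarrow> ennreal" where
  "sqrt_ennreal a = (if a = \<infinity> then \<infinity> else ennreal (sqrt (enn2real a)))"

text \<open>Only the values of a form on \<open>L0 M\<close> matter.\<close>

definition quadratic_form :: "'a measure \<Rightarrow> (('a \<Rightarrow> real) set \<Rightarrow> ennreal) \<Rightarrow> bool" where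
  "quadratic_form M q \<longleftrightarrow>
     (\<forall>u\<in>L0 M. \<forall>v\<in>L0 M. 2 * q u + 2 * q v = q (L0_add M u v) + q (L0_diff M u v)) \<and>
     (\<forall>u\<in>L0 M. \<forall>c. q (L0_scale M c u) = ennreal (\<bar>c\<bar>\<^sup>2) * q u)"

definition form_domain :: "'a measure \<Rightarrow> (('a \<Rightarrow> real) set \<Rightarrow> ennreal) \<Rightarrow> ('a \<Rightarrow> real) set set" where
  "form_domain M q = {u \<in> L0 M. q u < \<infinity>}"

definition form_seminorm_topology ::
  "'a measure \<Rightarrow> (('a \<Rightarrow> real) set \<Rightarrow> ennreal) \<Rightarrow> ('a \<Rightarrow> real) set topology" where
  "form_seminorm_topology M q = topology_generated_by
     {{v \<in> form_domain M q. sqrt_ennreal (q (L0_diff M v u)) < ennreal r} | u r.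
        u \<in> form_domain M q \<and> 0 < r}"

definition form_topology ::
  "'a measure \<Rightarrow> (('a \<Rightarrow> real) set \<Rightarrow> ennreal) \<Rightarrow> ('a \<Rightarrow> real) set topology" where
  "form_topology M q = topology_generated_by
     ({W. openin (subtopology (L0_topology M) (form_domain M q)) W} \<union>
      {W. openin (form_seminorm_topology M q) W})"

text \<open>
  Completeness of a linear subspace \<open>D\<close> of \<open>L0 M\<close> carrying a vector space topology \<open>T\<close>, with respect
  to the translation invariant uniformity of \<open>T\<close>, whose entourages are given by the neighbourhoods
  of zero. As \<open>T\<close> need not be metrizable, sequences do not suffice.
\<close>

definition L0_cauchy_filter ::
  "'a measure \<Rightarrow> ('a \<Rightarrow> real) set topology \<Rightarrow> ('a \<Rightarrow> real) set filter \<Rightarrow> bool" where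
  "L0_cauchy_filter M T F \<longleftrightarrow>
     (\<forall>N. openin T N \<and> L0_zero M \<in> N \<longrightarrow> (\<forall>\<^sub>F (u, v) in F \<times>\<^sub>F F. L0_diff M u v \<in> N))"

definition L0_complete ::
  "'a measure \<Rightarrow> ('a \<Rightarrow> real) set topology \<Rightarrow> ('a \<Rightarrow> real) set set \<Rightarrow> bool" where
  "L0_complete M T D \<longleftrightarrow>
     (\<forall>F\<le>principal D. F \<noteq> bot \<longrightarrow> L0_cauchy_filter M T F \<longrightarrow> (\<exists>u\<in>D. F \<le> nhdsin T u))"

definition closed_form :: "'a measure \<Rightarrow> (('a \<Rightarrow> real) set \<Rightarrow> ennreal) \<Rightarrow> bool" where
  "closed_form M q \<longleftrightarrow> quadratic_form M q \<and> L0_complete M (form_topology M q) (form_domain M q)"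


section \<open>Normal contractions and energy forms\<close>

text \<open>
  A map on \<open>\<real>\<^sup>n\<close> is represented by a function on sequences that depends on the first \<open>n\<close>
  coordinates only; the Lipschitz condition, required for all sequences, enforces the latter.
\<close>

definition normal_contraction :: "nat \<Rightarrow> ((nat \<Rightarrow> real) \<Rightarrow> real) \<Rightarrow> bool" where
  "normal_contraction n C \<longleftrightarrow>
     C (\<lambda>_. 0) = 0 \<and> (\<forall>x y. \<bar>C x - C y\<bar> \<le> (\<Sum>i<n. \<bar>x i - y i\<bar>))"

definition normal_contraction_real :: "(real \<Rightarrow> real) \<Rightarrow> bool" where
  "normal_contraction_real C \<longleftrightarrow> C 0 = 0 \<and> (\<forall>x y. \<bar>C x - C y\<bar> \<le> \<bar>x - y\<bar>)"

lemma normal_contraction_real_iff: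
  "normal_contraction_real C \<longleftrightarrow> normal_contraction 1 (\<lambda>x. C (x 0))"
proof
  assume "normal_contraction 1 (\<lambda>x. C (x 0))"
  then have "C 0 = 0" and *: "\<bar>C (x 0) - C (y 0)\<bar> \<le> \<bar>x 0 - y 0\<bar>" for x y :: "nat \<Rightarrow> real"
    by (auto simp: normal_contraction_def)
  then show "normal_contraction_real C"
    using *[of "\<lambda>_. s" "\<lambda>_. t" for s t] by (simp add: normal_contraction_real_def)
qed (auto simp: normal_contraction_def normal_contraction_real_def)

lemma borel_measurable_normal_contraction:
  assumes "normal_contraction n C" "\<And>k. k < n \<Longrightarrow> f k \<in> borel_measurable M"
  shows "(\<lambda>x. C (\<lambda>k. if k < n then f k x else 0)) \<in> borel_measurable M"
proof -
  have "isCont C x" for x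
  proof -
    have "continuous_on UNIV (\<lambda>y :: nat \<Rightarrow> real. y i)" for i
      by simp
    then have "((\<lambda>y. y i) \<longlongrightarrow> x i) (at x)" for i
      by (auto simp only: continuous_on_def)
    then have "((\<lambda>y. \<Sum>i<n. \<bar>y i - x i\<bar>) \<longlongrightarrow> (\<Sum>i<n. \<bar>x i - x i\<bar>)) (at x)"
      by (intro tendsto_sum tendsto_rabs tendsto_diff tendsto_const)
    then have lim: "((\<lambda>y. \<Sum>i<n. \<bar>y i - x i\<bar>) \<longlongrightarrow> 0) (at x)"
      by simp
    have "\<forall>\<^sub>F y in at x. norm (C y - C x) \<le> (\<Sum>i<n. \<bar>y i - x i\<bar>)"
      using assms(1) by (simp add: normal_contraction_def)
    then have "((\<lambda>y. C y - C x) \<longlongrightarrow> 0) (at x)"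
      using lim by (rule Lim_null_comparison)
    then show ?thesis by (simp add: isCont_def LIM_zero_iff)
  qed
  then have "C \<in> borel_measurable borel"
    by (intro borel_measurable_continuous_onI continuous_at_imp_continuous_on) auto
  moreover have "(\<lambda>x k. if k < n then f k x else 0) \<in> borel_measurable M"
  proof (rule measurable_coordinatewise_then_product)
    show "(\<lambda>x. if k < n then f k x else 0) \<in> borel_measurable M" for k
      using assms(2)[of k] by (cases "k < n") auto
  qed
  ultimately show ?thesis by (rule measurable_compose[rotated])
qed

lemma L0_map_n_class:
  assumes "normal_contraction n C" "\<And>k. k < n \<Longrightarrow> f k \<in> borel_measurable M"
  shows "L0_map_n M n C (\<lambda>k. L0_class M (f k)) =
         L0_class M (\<lambda>x. C (\<lambda>k. if k < n then f k x else 0))"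
proof -
  have "L0_class M (\<lambda>x. C (\<lambda>k. if k < n then g k x else 0)) =
        L0_class M (\<lambda>x. C (\<lambda>k. if k < n then f k x else 0))"
    if "g \<in> (\<Pi> k\<in>{..<n}. L0_class M (f k))" for g
  proof -
    have g: "g k \<in> borel_measurable M" "AE x in M. f k x = g k x" if "k < n" for k
      using L0_classD[of "g k" M "f k"] that \<open>g \<in> _\<close> by auto
    then have "AE x in M. \<forall>k\<in>{..<n}. f k x = g k x"
      by (intro AE_finite_allI) auto
    then have "AE x in M. C (\<lambda>k. if k < n then g k x else 0) = C (\<lambda>k. if k < n then f k x else 0)"
      by eventually_elim (auto intro!: arg_cong[of _ _ C])
    then show ?thesis
      using assms g by (intro L0_class_eqI borel_measurable_normal_contraction)
  qed
  moreover have "f \<in> (\<Pi> k\<in>{..<n}. L0_class M (f k))"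
    using assms(2) by (auto intro: L0_class_self)
  ultimately show ?thesis unfolding L0_map_n_def by (intro UN_constant_eq ballI)
qed

definition cutoff :: "real \<Rightarrow> (real \<Rightarrow> real) \<Rightarrow> bool" where
  "cutoff \<epsilon> C \<longleftrightarrow>
     normal_contraction_real C \<and> mono C \<and> (\<forall>x. - \<epsilon> \<le> C x \<and> C x \<le> 1 + \<epsilon>) \<and> (\<forall>x\<in>{0..1}. C x = x)"

definition markovian :: "'a measure \<Rightarrow> (('a \<Rightarrow> real) set \<Rightarrow> ennreal) \<Rightarrow> bool" where
  "markovian M q \<longleftrightarrow> (\<forall>\<epsilon>>0. \<exists>C. cutoff \<epsilon> C \<and> (\<forall>u\<in>L0 M. q (L0_map M C u) \<le> q u))"

definition energy_form :: "'a measure \<Rightarrow> (('a \<Rightarrow> real) set \<Rightarrow> ennreal) \<Rightarrow> bool" where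
  "energy_form M q \<longleftrightarrow> closed_form M q \<and> markovian M q"

end

theory Submission
  imports Defs
begin

text \<open>
  The substantial implication is from (i) to (iv). For a weight \<open>w \<ge> 0\<close> let \<open>E\<^sub>w f\<close> be the infimum of
  \<open>E u + \<integral> w (u - f)\<^sup>2\<close> over all \<open>u\<close>. This is again a quadratic form, it is bounded by \<open>E f\<close> and by
  \<open>\<integral> w f\<^sup>2\<close>, and every normal contraction that decreases \<open>E\<close> decreases \<open>E\<^sub>w\<close>. On step functions
  with finitely many values, the Markov property makes \<open>E\<^sub>w\<close> the energy of a finite weighted graph with
  killing, for which (iv) is Minkowski's inequality; continuity of \<open>E\<^sub>w\<close> with respect to \<open>\<integral> w f\<^sup>2\<close>
  extends (iv) to all functions for which the latter is finite.

  Finally \<open>E f\<close> is the supremum of the \<open>E\<^sub>w f\<close> over all weights that decay fast enough relative to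
  a given dominating function: by the parallelogram law the near minimisers form a Cauchy filter in
  the form topology, and as they converge to \<open>f\<close> locally in measure, completeness yields the claim.
  The dominating function makes it possible to work with weighted \<open>L\<^sup>2\<close> norms, for which the
  infimum is quadratic, although the topology of \<open>L\<^sup>0\<close> is not locally convex.
\<close>

section \<open>Quadratic forms on spaces of functions\<close>

text \<open>The deviation \<open>D\<close> of \<open>\<phi>\<close> from a linear map is additive
  and vanishes on the integers, so it is 1-periodic and inherits a global bound from the unit
  interval. Since \<open>D (n * t) = n * D t\<close>, boundedness forces it to vanish. This yields
  real homogeneity of the polarised form without a continuity argument.\<close>

lemma additive_bounded_imp_linear:
  fixes \<phi> :: "real \<Rightarrow> real"
  assumes add: "\<And>s t. \<phi> (s + t) = \<phi> s + \<phi> t"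
    and bdd: "\<And>t. 0 \<le> t \<Longrightarrow> t \<le> 1 \<Longrightarrow> \<bar>\<phi> t\<bar> \<le> K"
  shows "\<phi> t = t * \<phi> 1"
proof -
  define D where "D t = \<phi> t - t * \<phi> 1" for t
  have D_add: "D (s + t) = D s + D t" for s t
    by (simp add: D_def add algebra_simps)
  have D0: "D 0 = 0" and D1: "D 1 = 0"
    using D_add[of 0 0] by (auto simp: D_def)
  have D_nat: "D (real n * t) = real n * D t" for n t
    by (induction n) (auto simp: D0 D_add algebra_simps)
  have D_neg: "D (- t) = - D t" for t
    using D_add[of t "- t"] D0 by simp
  have D_int: "D (of_int z) = 0" for z
    using D_nat[of _ 1] D1 D_neg by (cases z rule: int_diff_cases) (auto simp: D_add[of _ "- _", simplified] )
  have D_bdd: "\<bar>D t\<bar> \<le> K + \<bar>\<phi> 1\<bar>" for t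
  proof -
    have "D t = D (frac t)"
      using D_add[of "of_int \<lfloor>t\<rfloor>" "frac t"] D_int by (simp add: frac_def)
    also have "\<bar>\<dots>\<bar> \<le> \<bar>\<phi> (frac t)\<bar> + \<bar>frac t * \<phi> 1\<bar>"
      unfolding D_def by (rule abs_triangle_ineq4)
    also have "\<bar>frac t * \<phi> 1\<bar> \<le> \<bar>\<phi> 1\<bar>"
      using frac_lt_1[of t] by (simp add: abs_mult mult_left_le_one_le)
    also have "\<bar>\<phi> (frac t)\<bar> \<le> K"
      using frac_lt_1[of t] by (intro bdd) auto
    finally show ?thesis by simp
  qed
  have "D t = 0"
  proof (rule ccontr)
    assume "D t \<noteq> 0"
    then obtain n where "real n * \<bar>D t\<bar> > K + \<bar>\<phi> 1\<bar>"
      using reals_Archimedean3[of "\<bar>D t\<bar>"] by auto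
    with D_bdd[of "real n * t"] show False by (simp add: D_nat abs_mult)
  qed
  then show ?thesis by (simp add: D_def)
qed

text \<open>Extended-valued forms will be restricted to the space where they are finite, so that
  polarisation takes place in the reals. The elements are functions rather than classes, which lets
  contractions act pointwise; \<open>q\<close> may vanish on nonzero functions.\<close>

locale quadratic_space =
  fixes V :: "('a \<Rightarrow> real) set" and q :: "('a \<Rightarrow> real) \<Rightarrow> real"
  assumes V_nonempty: "V \<noteq> {}"
    and V_add: "f \<in> V \<Longrightarrow> g \<in> V \<Longrightarrow> (\<lambda>x. f x + g x) \<in> V"
    and V_scale: "f \<in> V \<Longrightarrow> (\<lambda>x. c * f x) \<in> V"
    and q_nonneg: "f \<in> V \<Longrightarrow> 0 \<le> q f"
    and q_scale: "f \<in> V \<Longrightarrow> q (\<lambda>x. c * f x) = c\<^sup>2 * q f"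
    and parallelogram: "f \<in> V \<Longrightarrow> g \<in> V \<Longrightarrow>
      q (\<lambda>x. f x + g x) + q (\<lambda>x. f x - g x) = 2 * q f + 2 * q g"
begin

lemma V_zero: "(\<lambda>x. 0) \<in> V"
  using V_nonempty V_scale[of _ 0] by auto

lemma V_diff: "f \<in> V \<Longrightarrow> g \<in> V \<Longrightarrow> (\<lambda>x. f x - g x) \<in> V"
  using V_add[of f "\<lambda>x. - 1 * g x"] V_scale[of g "- 1"] by simp

lemma V_sum: "(\<And>i. i \<in> I \<Longrightarrow> f i \<in> V) \<Longrightarrow> (\<lambda>x. \<Sum>i\<in>I. f i x) \<in> V"
  by (induction I rule: infinite_finite_induct) (auto intro: V_zero V_add)

section \<open>Polarisation and the Cauchy-Schwarz inequality\<close>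

definition polar_form :: "('a \<Rightarrow> real) \<Rightarrow> ('a \<Rightarrow> real) \<Rightarrow> real" where
  "polar_form f g = (q (\<lambda>x. f x + g x) - q (\<lambda>x. f x - g x)) / 4"

lemma q_zero: "q (\<lambda>x. 0) = 0"
  using q_scale[OF V_zero, of 0] by simp

lemma q_minus: "f \<in> V \<Longrightarrow> q (\<lambda>x. - f x) = q f"
  using q_scale[of f "- 1"] by simp

lemma polar_form_self: "f \<in> V \<Longrightarrow> polar_form f f = q f"
  using q_scale[of f 2] by (simp add: polar_form_def q_zero flip: mult_2)

lemma polar_form_commute:
  assumes "f \<in> V" "g \<in> V"
  shows "polar_form f g = polar_form g f"
  using q_minus[OF V_diff[OF assms]] by (simp add: polar_form_def add.commute)

text \<open>The difference of the parallelogram laws for the pairs \<open>f + h\<close>,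
  \<open>g + h\<close> and \<open>f - h\<close>, \<open>g - h\<close> is the identity
  \<open>*\<close>, with \<open>2 * h\<close> as second argument. Its instance with one function
  equal to zero removes the factor 2.\<close>

lemma polar_form_add_left:
  assumes f: "f \<in> V" and g: "g \<in> V" and h: "h \<in> V"
  shows "polar_form (\<lambda>x. f x + g x) h = polar_form f h + polar_form g h"
proof -
  have *: "2 * (polar_form f h + polar_form g h) = polar_form (\<lambda>x. f x + g x) (\<lambda>x. 2 * h x)" if "f \<in> V" "g \<in> V" for f g
    using parallelogram[OF V_add[OF that(1) h] V_add[OF that(2) h]]
      parallelogram[OF V_diff[OF that(1) h] V_diff[OF that(2) h]]
    by (simp add: polar_form_def field_simps)
  have "polar_form (\<lambda>x. 0) h = 0"
    using q_minus[OF h] by (simp add: polar_form_def)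
  then have "2 * polar_form k h = polar_form k (\<lambda>x. 2 * h x)" if "k \<in> V" for k
    using *[OF that V_zero] by simp
  from *[OF f g] this[OF V_add[OF f g]] show ?thesis by simp
qed

lemma polar_form_bound:
  assumes "f \<in> V" "g \<in> V"
  shows "\<bar>polar_form f g\<bar> \<le> (q f + q g) / 2"
  using parallelogram[OF assms] q_nonneg[OF V_add[OF assms]] q_nonneg[OF V_diff[OF assms]]
  by (simp add: polar_form_def field_simps abs_le_iff)

text \<open>As a function of the scalar the left side is additive and, by
  \<open>polar_form_bound\<close>, bounded on the unit interval, hence linear.\<close>

lemma polar_form_scale_left:
  assumes f: "f \<in> V" and g: "g \<in> V"
  shows "polar_form (\<lambda>x. c * f x) g = c * polar_form f g"
proof -
  have "(\<lambda>c. polar_form (\<lambda>x. c * f x) g) c = c * (\<lambda>c. polar_form (\<lambda>x. c * f x) g) 1"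
  proof (rule additive_bounded_imp_linear)
    show "polar_form (\<lambda>x. (s + t) * f x) g = polar_form (\<lambda>x. s * f x) g + polar_form (\<lambda>x. t * f x) g" for s t
      using polar_form_add_left[OF V_scale[OF f] V_scale[OF f] g] by (simp add: distrib_right)
    show "\<bar>polar_form (\<lambda>x. t * f x) g\<bar> \<le> (q f + q g) / 2" if "0 \<le> t" "t \<le> 1" for t
    proof -
      have "t\<^sup>2 * q f \<le> q f"
        using that q_nonneg[OF f] by (simp add: mult_left_le_one_le power_le_one)
      then show ?thesis
        using polar_form_bound[OF V_scale[OF f] g, of t] by (simp add: q_scale[OF f])
    qed
  qed
  then show ?thesis by simp
qed

lemma polar_form_sum_left:
  assumes "\<And>i. i \<in> I \<Longrightarrow> f i \<in> V" "g \<in> V"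
  shows "polar_form (\<lambda>x. \<Sum>i\<in>I. c i * f i x) g = (\<Sum>i\<in>I. c i * polar_form (f i) g)"
  using assms(1)
proof (induction I rule: infinite_finite_induct)
  case (insert j I)
  then show ?case
    using assms(2) by (simp add: polar_form_add_left V_scale V_sum polar_form_scale_left)
qed (use q_minus[OF assms(2)] in \<open>auto simp: polar_form_def\<close>)

lemma q_sum:
  assumes "\<And>i. i \<in> I \<Longrightarrow> f i \<in> V"
  shows "q (\<lambda>x. \<Sum>i\<in>I. c i * f i x) = (\<Sum>i\<in>I. \<Sum>j\<in>I. c i * c j * polar_form (f i) (f j))"
proof -
  have V: "(\<lambda>x. \<Sum>i\<in>I. c i * f i x) \<in> V"
    using assms by (intro V_sum V_scale)
  have "q (\<lambda>x. \<Sum>i\<in>I. c i * f i x) = (\<Sum>i\<in>I. c i * polar_form (f i) (\<lambda>x. \<Sum>i\<in>I. c i * f i x))"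
    using polar_form_sum_left[of I f _ c, OF assms V] polar_form_self[OF V] by simp
  also have "\<dots> = (\<Sum>i\<in>I. \<Sum>j\<in>I. c i * c j * polar_form (f i) (f j))"
  proof (rule sum.cong)
    fix i assume i: "i \<in> I"
    show "c i * polar_form (f i) (\<lambda>x. \<Sum>i\<in>I. c i * f i x) = (\<Sum>j\<in>I. c i * c j * polar_form (f i) (f j))"
      using polar_form_sum_left[OF assms assms[OF i], where c=c] polar_form_commute[OF assms[OF i] V]
        polar_form_commute[OF assms[OF i] assms] by (simp add: sum_distrib_left mult.assoc)
  qed simp
  finally show ?thesis .
qed

lemma q_add_scaled:
  assumes f: "f \<in> V" and g: "g \<in> V"
  shows "q (\<lambda>x. f x + t * g x) = q f + 2 * t * polar_form f g + t\<^sup>2 * q g"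
proof -
  have tg: "(\<lambda>x. t * g x) \<in> V" by (rule V_scale[OF g])
  have "q (\<lambda>x. f x + t * g x) = polar_form f (\<lambda>x. f x + t * g x) + t * polar_form g (\<lambda>x. f x + t * g x)"
    using polar_form_self[OF V_add[OF f tg]] polar_form_add_left[OF f tg V_add[OF f tg]]
      polar_form_scale_left[OF g V_add[OF f tg]] by simp
  moreover have "polar_form h (\<lambda>x. f x + t * g x) = polar_form h f + t * polar_form h g" if "h \<in> V" for h
    using polar_form_add_left[OF f tg that] polar_form_scale_left[OF g that] polar_form_commute that f g tg V_add by simp
  ultimately show ?thesis
    using f g polar_form_commute[OF f g] by (simp add: polar_form_self algebra_simps power2_eq_square)
qed

lemma polar_form_le:
  assumes f: "f \<in> V" and g: "g \<in> V"
  shows "polar_form f g \<le> sqrt (q f) * sqrt (q g)"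
proof (cases "q g = 0")
  case True
  have "polar_form f g \<le> 0"
  proof (rule ccontr)
    assume "\<not> polar_form f g \<le> 0"
    \<comment> \<open>When \<open>q g = 0\<close> the value is affine in the coefficient of
      \<open>g\<close>; this coefficient makes it \<open>- 1\<close>.\<close>
    then have "q (\<lambda>x. f x + - (q f + 1) / (2 * polar_form f g) * g x) < 0"
      unfolding q_add_scaled[OF f g] True by (simp add: field_simps)
    with q_nonneg[OF V_add[OF f V_scale[OF g]]] show False by (meson not_less)
  qed
  with True show ?thesis by simp
next
  case False
  with q_nonneg[OF g] have g0: "q g > 0" by simp
  \<comment> \<open>The coefficient of \<open>g\<close> is the minimiser of the quadratic polynomial
    in \<open>q_add_scaled\<close>.\<close>
  have "0 \<le> q (\<lambda>x. f x + - polar_form f g / q g * g x)"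
    by (intro q_nonneg V_add V_scale f g)
  also have "\<dots> = q f - (polar_form f g)\<^sup>2 / q g"
    unfolding q_add_scaled[OF f g] using g0 by (simp add: field_simps power2_eq_square)
  finally have "(polar_form f g)\<^sup>2 \<le> q f * q g"
    using g0 by (simp add: field_simps)
  then show ?thesis
    by (metis abs_ge_self order_trans real_sqrt_abs real_sqrt_le_iff real_sqrt_mult)
qed

lemma q_triangle:
  assumes f: "f \<in> V" and g: "g \<in> V"
  shows "sqrt (q (\<lambda>x. f x + g x)) \<le> sqrt (q f) + sqrt (q g)"
proof (rule real_le_lsqrt)
  show "q (\<lambda>x. f x + g x) \<le> (sqrt (q f) + sqrt (q g))\<^sup>2"
    using q_add_scaled[OF f g, of 1] polar_form_le[OF f g] q_nonneg f g by (simp add: power2_sum)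
qed (use q_nonneg[OF V_add[OF f g]] q_nonneg f g in auto)

lemma q_triangle_diff:
  assumes f: "f \<in> V" and g: "g \<in> V"
  shows "sqrt (q f) \<le> sqrt (q g) + sqrt (q (\<lambda>x. f x - g x))"
  using q_triangle[OF g V_diff[OF f g]] by simp

end

section \<open>Markovian forms on indicators and step functions\<close>

locale markovian_quadratic_space = quadratic_space +
  assumes cutoffs: "0 < \<epsilon> \<Longrightarrow> \<exists>C. cutoff \<epsilon> C \<and> (\<forall>f\<in>V. (\<lambda>x. C (f x)) \<in> V \<and> q (\<lambda>x. C (f x)) \<le> q f)"
begin

text \<open>A cutoff fixes 0 and 1 and moves \<open>- s'\<close> to some \<open>t\<close> between
  \<open>- s' / 2\<close> and 0. On indicators of disjoint sets it therefore turns
  \<open>f - s' * g\<close> into \<open>f + t * g\<close>. Comparing the two energies bounds the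
  polar form above by a multiple of \<open>s'\<close>, which is arbitrarily small.\<close>

lemma polar_form_nonpos_of_disjoint:
  assumes f: "f \<in> V" "\<And>x. f x \<in> {0, 1}" and g: "g \<in> V" "\<And>x. g x \<in> {0, 1}"
    and disj: "\<And>x. f x * g x = 0"
  shows "polar_form f g \<le> 0"
proof (rule field_le_epsilon)
  fix s :: real assume "0 < s"
  define s' where "s' = s / (q g + 1)"
  have "0 < s'" "s' * q g \<le> s"
    using \<open>0 < s\<close> q_nonneg[OF g(1)] by (auto simp: s'_def field_simps)
  \<comment> \<open>Halving the parameter ensures \<open>t + s' > 0\<close>, the factor cancelled
    below.\<close>
  obtain C where C: "cutoff (s' / 2) C" "\<And>f. f \<in> V \<Longrightarrow> q (\<lambda>x. C (f x)) \<le> q f"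
    using cutoffs[of "s' / 2"] \<open>0 < s'\<close> by auto
  have C01: "C 0 = 0" "C 1 = 1" using C(1) by (auto simp: cutoff_def)
  define t where "t = C (- s')"
  have t: "- (s' / 2) \<le> t" "t \<le> 0"
    using C(1) \<open>0 < s'\<close> monoD[of C "- s'" 0] by (auto simp: cutoff_def t_def C01)
  have "C (f x + - s' * g x) = f x + t * g x" for x
    using f(2)[of x] g(2)[of x] disj[of x] by (auto simp: t_def C01)
  with C(2)[OF V_add[OF f(1) V_scale[OF g(1)]], of "- s'"]
  have "q (\<lambda>x. f x + t * g x) \<le> q (\<lambda>x. f x + - s' * g x)" by simp
  then have "(t + s') * (2 * polar_form f g) \<le> (t + s') * ((s' - t) * q g)"
    unfolding q_add_scaled[OF f(1) g(1)] by (simp add: algebra_simps power2_eq_square)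
  then have "2 * polar_form f g \<le> (s' - t) * q g"
    using t \<open>0 < s'\<close> by (subst (asm) mult_le_cancel_left_pos) auto
  also have "\<dots> \<le> (2 * s') * q g"
    using t \<open>0 < s'\<close> q_nonneg[OF g(1)] by (intro mult_right_mono) auto
  finally show "polar_form f g \<le> 0 + s" using \<open>s' * q g \<le> s\<close> by simp
qed

text \<open>The same perturbation argument at the upper end: \<open>g\<close> lives where
  \<open>f\<close> is 1, so \<open>f + s' * g\<close> takes only the values 0, 1 and
  \<open>1 + s'\<close>, and the cutoff lowers the last one to \<open>1 + t\<close> with
  \<open>t \<le> s' / 2\<close>.\<close>

lemma polar_form_nonneg_of_le:
  assumes f: "f \<in> V" "\<And>x. f x \<in> {0, 1}" and g: "g \<in> V" "\<And>x. g x \<in> {0, 1}"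
    and le: "\<And>x. g x \<le> f x"
  shows "0 \<le> polar_form f g"
proof (rule field_le_epsilon)
  fix s :: real assume "0 < s"
  define s' where "s' = s / (q g + 1)"
  have "0 < s'" "s' * q g \<le> s"
    using \<open>0 < s\<close> q_nonneg[OF g(1)] by (auto simp: s'_def field_simps)
  obtain C where C: "cutoff (s' / 2) C" "\<And>f. f \<in> V \<Longrightarrow> q (\<lambda>x. C (f x)) \<le> q f"
    using cutoffs[of "s' / 2"] \<open>0 < s'\<close> by auto
  have C01: "C 0 = 0" "C 1 = 1" using C(1) by (auto simp: cutoff_def)
  define t where "t = C (1 + s') - 1"
  have "C (1 + s') \<le> 1 + s' / 2" "mono C"
    using C(1) by (auto simp: cutoff_def)
  moreover have "C 1 \<le> C (1 + s')"
    using \<open>0 < s'\<close> by (intro monoD[OF \<open>mono C\<close>]) simp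
  ultimately have t: "t \<le> s' / 2" "0 \<le> t"
    by (auto simp: t_def C01)
  have "C (f x + s' * g x) = f x + t * g x" for x
    using f(2)[of x] g(2)[of x] le[of x] by (auto simp: t_def C01)
  with C(2)[OF V_add[OF f(1) V_scale[OF g(1)]], of "s'"]
  have "q (\<lambda>x. f x + t * g x) \<le> q (\<lambda>x. f x + s' * g x)" by simp
  then have "(s' - t) * (- (s' + t) * q g) \<le> (s' - t) * (2 * polar_form f g)"
    unfolding q_add_scaled[OF f(1) g(1)] by (simp add: algebra_simps power2_eq_square)
  then have "- ((s' + t) * q g) \<le> 2 * polar_form f g"
    using t \<open>0 < s'\<close> by (subst (asm) mult_le_cancel_left_pos) (auto simp: algebra_simps)
  moreover have "(s' + t) * q g \<le> (2 * s') * q g"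
    using t \<open>0 < s'\<close> q_nonneg[OF g(1)] by (intro mult_right_mono) auto
  ultimately show "0 \<le> polar_form f g + s" using \<open>s' * q g \<le> s\<close> by simp
qed

text \<open>
  On step functions over a finite partition the form is that of a finite weighted graph with killing
  term, i.e. a weighted sum of squares of differences and of values, so that the claim is
  Minkowski's inequality.
\<close>

lemma step_functions_contraction:
  fixes T :: "'a \<Rightarrow> 'i" and a :: "'i \<Rightarrow> real" and b :: "nat \<Rightarrow> 'i \<Rightarrow> real"
  assumes fin: "finite I"
    and V: "\<And>i. i \<in> I \<Longrightarrow> (\<lambda>x. of_bool (T x = i)) \<in> V"
    and val: "\<And>i. i \<in> I \<Longrightarrow> \<bar>a i\<bar> \<le> (\<Sum>k<n. \<bar>b k i\<bar>)"
    and diff: "\<And>i j. i \<in> I \<Longrightarrow> j \<in> I \<Longrightarrow> \<bar>a i - a j\<bar> \<le> (\<Sum>k<n. \<bar>b k i - b k j\<bar>)"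
  shows "sqrt (q (\<lambda>x. \<Sum>i\<in>I. a i * of_bool (T x = i)))
    \<le> (\<Sum>k<n. sqrt (q (\<lambda>x. \<Sum>i\<in>I. b k i * of_bool (T x = i))))"
proof -
  define e :: "'i \<Rightarrow> 'a \<Rightarrow> real" where "e i x = of_bool (T x = i)" for i x
  have e: "e i \<in> V" if "i \<in> I" for i using V[OF that] by (simp add: e_def[abs_def])
  have eV: "(\<lambda>x. \<Sum>i\<in>I. e i x) \<in> V" by (rule V_sum) (rule e)
  \<comment> \<open>In the graph with vertex set \<open>I\<close>, \<open>c\<close> is the killing
    weight and \<open>d\<close> the edge weight. The latter is halved because \<open>J\<close> below
    contains both orderings of each pair.\<close>
  define c where "c i = (\<Sum>j\<in>I. polar_form (e i) (e j))" for i
  define d where "d i j = (if i = j then 0 else - polar_form (e i) (e j) / 2)" for i j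
  have c: "0 \<le> c i" if i: "i \<in> I" for i
  proof -
    \<comment> \<open>The sum of the cell indicators is itself an indicator and lies above
      \<open>e i\<close>.\<close>
    have "(\<Sum>j\<in>I. e j x) = of_bool (T x \<in> I)" for x
      using fin by (simp add: e_def of_bool_def)
    then have "0 \<le> polar_form (\<lambda>x. \<Sum>j\<in>I. e j x) (e i)"
      using e[OF i] eV i by (intro polar_form_nonneg_of_le) (auto simp: e_def)
    also have "\<dots> = c i"
      using polar_form_sum_left[of I e "e i" "\<lambda>_. 1"] e i polar_form_commute[OF e e] by (simp add: c_def)
    finally show ?thesis .
  qed
  have d: "0 \<le> d i j" if "i \<in> I" "j \<in> I" for i j
  proof (cases "i = j")
    case False
    have "polar_form (e i) (e j) \<le> 0"
      by (rule polar_form_nonpos_of_disjoint) (use False that e in \<open>auto simp: e_def\<close>)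
    with False show ?thesis by (simp add: d_def)
  qed (simp add: d_def)
  define J where "J = I <+> I \<times> I"
  have J: "finite J" unfolding J_def using fin by simp
  \<comment> \<open>\<open>\<Phi>\<close> is linear in \<open>v\<close> and embeds step functions
    into a finite-dimensional Euclidean space, with one coordinate per killing term and one per
    ordered pair.\<close>
  define \<Phi> where "\<Phi> v t = (case t of Inl i \<Rightarrow> sqrt (c i) * v i
    | Inr (i, j) \<Rightarrow> sqrt (d i j) * (v i - v j))" for v :: "'i \<Rightarrow> real" and t
  \<comment> \<open>The product \<open>v i * v j\<close> is half of
    \<open>(v i)\<^sup>2 + (v j)\<^sup>2 - (v i - v j)\<^sup>2\<close>. Summed against the polar
    form, the pure squares collect into the killing weights \<open>c\<close>.\<close>
  have rep: "sqrt (q (\<lambda>x. \<Sum>i\<in>I. v i * e i x)) = L2_set (\<Phi> v) J" for v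
  proof -
    have "d i j * (v i - v j)\<^sup>2 = - (polar_form (e i) (e j) * (v i - v j)\<^sup>2 / 2)" for i j
      by (simp add: d_def)
    then have "(\<Sum>t\<in>J. (\<Phi> v t)\<^sup>2)
      = (\<Sum>i\<in>I. c i * (v i)\<^sup>2) - (\<Sum>i\<in>I. \<Sum>j\<in>I. polar_form (e i) (e j) * (v i - v j)\<^sup>2 / 2)"
      unfolding J_def using fin c d
      by (simp add: sum.Plus \<Phi>_def power_mult_distrib sum.cartesian_product' sum_negf
          split_beta cong: sum.cong flip: sum.cartesian_product)
    also have "(\<Sum>i\<in>I. \<Sum>j\<in>I. polar_form (e i) (e j) * (v i - v j)\<^sup>2 / 2)
      = (\<Sum>i\<in>I. \<Sum>j\<in>I. polar_form (e i) (e j) * (v i)\<^sup>2 / 2) + (\<Sum>i\<in>I. \<Sum>j\<in>I. polar_form (e i) (e j) * (v j)\<^sup>2 / 2)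
        - (\<Sum>i\<in>I. \<Sum>j\<in>I. v i * v j * polar_form (e i) (e j))"
      by (simp add: power2_diff field_simps flip: sum.distrib sum_subtractf)
    also have "(\<Sum>i\<in>I. \<Sum>j\<in>I. polar_form (e i) (e j) * (v j)\<^sup>2 / 2) = (\<Sum>i\<in>I. \<Sum>j\<in>I. polar_form (e i) (e j) * (v i)\<^sup>2 / 2)"
      by (subst sum.swap) (auto intro!: sum.cong simp: polar_form_commute e)
    also have "(\<Sum>i\<in>I. \<Sum>j\<in>I. polar_form (e i) (e j) * (v i)\<^sup>2 / 2) = (\<Sum>i\<in>I. c i * (v i)\<^sup>2) / 2"
      by (simp add: c_def sum_distrib_right sum_divide_distrib)
    finally show ?thesis
      by (simp add: L2_set_def q_sum[of I e v] e)
  qed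
  have le: "\<bar>\<Phi> a t\<bar> \<le> (\<Sum>k<n. \<bar>\<Phi> (b k) t\<bar>)" if "t \<in> J" for t
  proof (cases t)
    case (Inl i)
    with that c[of i] val[of i] show ?thesis
      by (auto simp: J_def \<Phi>_def abs_mult mult_left_mono simp flip: sum_distrib_left)
  next
    case (Inr p)
    with that d[of "fst p" "snd p"] diff[of "fst p" "snd p"] show ?thesis
      by (auto simp: J_def \<Phi>_def abs_mult mult_left_mono simp flip: sum_distrib_left)
  qed
  have L2_sum: "L2_set (\<lambda>t. \<Sum>k<m. \<bar>\<Phi> (b k) t\<bar>) J \<le> (\<Sum>k<m. L2_set (\<Phi> (b k)) J)" for m
  proof (induction m)
    case (Suc m)
    have "L2_set (\<lambda>t. \<bar>\<Phi> (b m) t\<bar>) J = L2_set (\<Phi> (b m)) J" by (simp add: L2_set_def)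
    with L2_set_triangle_ineq[of "\<lambda>t. \<Sum>k<m. \<bar>\<Phi> (b k) t\<bar>" "\<lambda>t. \<bar>\<Phi> (b m) t\<bar>" J] Suc
    show ?case by simp
  qed (simp add: L2_set_def)
  have "L2_set (\<Phi> a) J = L2_set (\<lambda>t. \<bar>\<Phi> a t\<bar>) J" by (simp add: L2_set_def)
  also have "\<dots> \<le> L2_set (\<lambda>t. \<Sum>k<n. \<bar>\<Phi> (b k) t\<bar>) J"
    by (rule L2_set_mono) (auto simp: le)
  also note L2_sum[of n]
  finally show ?thesis by (simp add: rep[unfolded e_def])
qed

end


section \<open>Infimal convolutions with weighted square integrals\<close>

text \<open>A common format for the given form, evaluated on classes of functions, and for weighted
  square integrals. It lives on functions, where their infimal convolution can be formed
  directly.\<close>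

definition quadratic_functional :: "'a measure \<Rightarrow> (('a \<Rightarrow> real) \<Rightarrow> ennreal) \<Rightarrow> bool" where
  "quadratic_functional M p \<longleftrightarrow>
     (\<forall>f\<in>borel_measurable M. \<forall>g\<in>borel_measurable M.
        p (\<lambda>x. f x + g x) + p (\<lambda>x. f x - g x) = 2 * p f + 2 * p g) \<and>
     (\<forall>f\<in>borel_measurable M. \<forall>c. p (\<lambda>x. c * f x) = ennreal (c\<^sup>2) * p f)"

lemma quadratic_functional_zero:
  "quadratic_functional M p \<Longrightarrow> p (\<lambda>x. 0) = 0"
  unfolding quadratic_functional_def using borel_measurable_const[of 0 M]
  by (auto dest!: bspec[of _ _ "\<lambda>x. 0"] spec[of _ "0::real"])

text \<open>The parallelogram law bounds the values at the sum and the difference by those at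
  \<open>f\<close> and \<open>g\<close>. Hence the finiteness domain is a vector space, and all
  conversions to reals are faithful there.\<close>

lemma quadratic_space_quadratic_functional:
  assumes p: "quadratic_functional M p"
  shows "quadratic_space {f \<in> borel_measurable M. p f < \<infinity>} (\<lambda>f. enn2real (p f))"
proof
  have add: "p (\<lambda>x. f x + g x) + p (\<lambda>x. f x - g x) = 2 * p f + 2 * p g"
    if "f \<in> borel_measurable M" "g \<in> borel_measurable M" for f g :: "'a \<Rightarrow> real"
    using p that by (auto simp: quadratic_functional_def)
  have scale: "p (\<lambda>x. c * f x) = ennreal (c\<^sup>2) * p f"
    if "f \<in> borel_measurable M" for f :: "'a \<Rightarrow> real" and c
    using p that by (auto simp: quadratic_functional_def)
  let ?V = "{f \<in> borel_measurable M. p f < \<infinity>}"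
  have "(\<lambda>x. 0) \<in> ?V"
    using quadratic_functional_zero[OF p] by simp
  then show "?V \<noteq> {}" by blast
  have fin: "p (\<lambda>x. f x + g x) < \<infinity> \<and> p (\<lambda>x. f x - g x) < \<infinity>" if "f \<in> ?V" "g \<in> ?V" for f g
  proof -
    have "p (\<lambda>x. f x + g x) + p (\<lambda>x. f x - g x) < \<infinity>"
      using add[of f g] that by (simp add: ennreal_mult_less_top)
    then show ?thesis by simp
  qed
  show "(\<lambda>x. f x + g x) \<in> ?V" if "f \<in> ?V" "g \<in> ?V" for f g
    using fin[OF that] that by auto
  show "(\<lambda>x. c * f x) \<in> ?V" if "f \<in> ?V" for f c
    using that by (auto simp: scale ennreal_mult_less_top)
  show "enn2real (p (\<lambda>x. c * f x)) = c\<^sup>2 * enn2real (p f)" if "f \<in> ?V" for f c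
    using that by (simp add: scale enn2real_mult)
  show "enn2real (p (\<lambda>x. f x + g x)) + enn2real (p (\<lambda>x. f x - g x)) = 2 * enn2real (p f) + 2 * enn2real (p g)"
    if "f \<in> ?V" "g \<in> ?V" for f g
  proof -
    have "enn2real (p (\<lambda>x. f x + g x) + p (\<lambda>x. f x - g x)) = enn2real (2 * p f + 2 * p g)"
      using add that by simp
    then show ?thesis
      using fin[OF that] that by (simp add: enn2real_plus enn2real_mult ennreal_mult_less_top)
  qed
qed simp

section \<open>Infimal convolution, a Moreau-Yosida type regularisation\<close>

definition inf_conv ::
  "'a measure \<Rightarrow> (('a \<Rightarrow> real) \<Rightarrow> ennreal) \<Rightarrow> (('a \<Rightarrow> real) \<Rightarrow> ennreal) \<Rightarrow> ('a \<Rightarrow> real) \<Rightarrow> ennreal" where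
  "inf_conv M p n f = (INF u\<in>borel_measurable M. p u + n (\<lambda>x. u x - f x))"

lemma inf_conv_lower: "u \<in> borel_measurable M \<Longrightarrow> inf_conv M p n f \<le> p u + n (\<lambda>x. u x - f x)"
  unfolding inf_conv_def by (rule INF_lower)

lemma inf_conv_approx:
  assumes "inf_conv M p n f < c"
  obtains u where "u \<in> borel_measurable M" "p u + n (\<lambda>x. u x - f x) < c"
  using assms unfolding inf_conv_def INF_less_iff by blast

lemma inf_conv_le_left:
  "quadratic_functional M n \<Longrightarrow> f \<in> borel_measurable M \<Longrightarrow> inf_conv M p n f \<le> p f"
  using inf_conv_lower[of f M p n f] by (simp add: quadratic_functional_zero)

lemma inf_conv_le_right:
  assumes "quadratic_functional M p" "quadratic_functional M n" "f \<in> borel_measurable M"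
  shows "inf_conv M p n f \<le> n f"
proof -
  have "n (\<lambda>x. - 1 * f x) = ennreal ((- 1)\<^sup>2) * n f"
    using assms(2,3) unfolding quadratic_functional_def by blast
  then show ?thesis
    using inf_conv_lower[of "\<lambda>x. 0" M p n f] quadratic_functional_zero[OF assms(1)] by simp
qed

text \<open>
  No minimiser is needed to see that the infimal convolution is again quadratic: one inequality in
  the parallelogram law is inherited from the summands, and the other one follows by applying it to
  \<open>f + g\<close> and \<open>f - g\<close>.
\<close>

lemma quadratic_functional_inf_conv:
  assumes p: "quadratic_functional M p" and n: "quadratic_functional M n"
  shows "quadratic_functional M (inf_conv M p n)"
proof -
  let ?Q = "inf_conv M p n" and ?\<Phi> = "\<lambda>f u. p u + n (\<lambda>x. u x - f x)"
  have padd: "p (\<lambda>x. f x + g x) + p (\<lambda>x. f x - g x) = 2 * p f + 2 * p g"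
    and nadd: "n (\<lambda>x. f x + g x) + n (\<lambda>x. f x - g x) = 2 * n f + 2 * n g"
    and pscale: "p (\<lambda>x. c * f x) = ennreal (c\<^sup>2) * p f"
    and nscale: "n (\<lambda>x. c * f x) = ennreal (c\<^sup>2) * n f"
    if "f \<in> borel_measurable M" "g \<in> borel_measurable M" for f g :: "'a \<Rightarrow> real" and c
    using p n that by (auto simp: quadratic_functional_def)
  \<comment> \<open>For nonzero \<open>c\<close> the infimum is reparametrised by
    \<open>u = c * v\<close>. The reverse inequality is this one applied with
    \<open>1 / c\<close>.\<close>
  have scale_ge: "ennreal (c\<^sup>2) * ?Q f \<le> ?Q (\<lambda>x. c * f x)"
    if f: "f \<in> borel_measurable M" and c: "c \<noteq> 0" for f :: "'a \<Rightarrow> real" and c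
    unfolding inf_conv_def[of _ _ _ "\<lambda>x. c * f x"]
  proof (rule INF_greatest)
    fix u :: "'a \<Rightarrow> real" assume u: "u \<in> borel_measurable M"
    define v where "v x = u x / c" for x
    have v: "v \<in> borel_measurable M" using u by (simp add: v_def[abs_def])
    have "ennreal (c\<^sup>2) * ?Q f \<le> ennreal (c\<^sup>2) * ?\<Phi> f v"
      by (intro mult_left_mono inf_conv_lower v) simp
    also have "\<dots> = p (\<lambda>x. c * v x) + n (\<lambda>x. c * (v x - f x))"
      using v f by (simp only: distrib_left pscale nscale borel_measurable_diff)
    also have "\<dots> = ?\<Phi> (\<lambda>x. c * f x) u"
      using c by (simp add: v_def right_diff_distrib)
    finally show "ennreal (c\<^sup>2) * ?Q f \<le> ?\<Phi> (\<lambda>x. c * f x) u" .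
  qed
  have scale: "?Q (\<lambda>x. c * f x) = ennreal (c\<^sup>2) * ?Q f"
    if f: "f \<in> borel_measurable M" for f :: "'a \<Rightarrow> real" and c
  proof (cases "c = 0")
    case True
    then show ?thesis
      using inf_conv_le_left[OF n, of "\<lambda>x. 0" p] quadratic_functional_zero[OF p] by simp
  next
    case False
    have "ennreal ((1 / c)\<^sup>2) * ?Q (\<lambda>x. c * f x) \<le> ?Q f"
      using scale_ge[of "\<lambda>x. c * f x" "1 / c"] f False by simp
    then have "ennreal (c\<^sup>2) * (ennreal ((1 / c)\<^sup>2) * ?Q (\<lambda>x. c * f x)) \<le> ennreal (c\<^sup>2) * ?Q f"
      by (rule mult_left_mono) simp
    then have "?Q (\<lambda>x. c * f x) \<le> ennreal (c\<^sup>2) * ?Q f"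
      using False by (simp add: power_divide flip: mult.assoc ennreal_mult)
    with scale_ge[OF f False] show ?thesis by simp
  qed
  \<comment> \<open>If \<open>u\<close> and \<open>v\<close> nearly minimise for \<open>f\<close>
    and \<open>g\<close>, then their sum and difference compete for \<open>f + g\<close> and
    \<open>f - g\<close>. The two errors \<open>e / 4\<close> are doubled and add up to
    \<open>e\<close>.\<close>
  have le: "?Q (\<lambda>x. f x + g x) + ?Q (\<lambda>x. f x - g x) \<le> 2 * ?Q f + 2 * ?Q g"
    if f: "f \<in> borel_measurable M" and g: "g \<in> borel_measurable M" for f g :: "'a \<Rightarrow> real"
  proof (rule ennreal_le_epsilon)
    fix e :: real assume e: "0 < e" and "2 * ?Q f + 2 * ?Q g < top"
    then have "?Q f < top" "?Q g < top"
      by (auto simp: ennreal_mult_less_top)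
    then have Q_lt: "?Q f < ?Q f + ennreal (e / 4)" "?Q g < ?Q g + ennreal (e / 4)"
      using e by (auto simp: ennreal_add_left_cancel_less[of _ 0, simplified])
    obtain u where u: "u \<in> borel_measurable M" "?\<Phi> f u < ?Q f + ennreal (e / 4)"
      using inf_conv_approx[OF Q_lt(1)] .
    obtain v where v: "v \<in> borel_measurable M" "?\<Phi> g v < ?Q g + ennreal (e / 4)"
      using inf_conv_approx[OF Q_lt(2)] .
    note uv = u(1) v(1) and lt = u(2) v(2)
    have "?Q (\<lambda>x. f x + g x) + ?Q (\<lambda>x. f x - g x)
      \<le> ?\<Phi> (\<lambda>x. f x + g x) (\<lambda>x. u x + v x) + ?\<Phi> (\<lambda>x. f x - g x) (\<lambda>x. u x - v x)"
      using uv by (intro add_mono inf_conv_lower) auto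
    also have "\<dots> = (p (\<lambda>x. u x + v x) + p (\<lambda>x. u x - v x))
      + (n (\<lambda>x. (u x - f x) + (v x - g x)) + n (\<lambda>x. (u x - f x) - (v x - g x)))"
      by (simp add: algebra_simps)
    also have "\<dots> = (2 * p u + 2 * p v) + (2 * n (\<lambda>x. u x - f x) + 2 * n (\<lambda>x. v x - g x))"
      using uv f g by (simp only: padd nadd borel_measurable_diff)
    also have "\<dots> = 2 * ?\<Phi> f u + 2 * ?\<Phi> g v"
      by (simp add: distrib_left add_ac)
    also have "\<dots> \<le> 2 * (?Q f + ennreal (e / 4)) + 2 * (?Q g + ennreal (e / 4))"
      using lt by (intro add_mono[of "2 * _"] mult_left_mono) auto
    also have "\<dots> = 2 * ?Q f + 2 * ?Q g + (ennreal 2 * ennreal (e / 4) + ennreal 2 * ennreal (e / 4))"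
      by (simp add: distrib_left add_ac)
    also have "ennreal 2 * ennreal (e / 4) + ennreal 2 * ennreal (e / 4) = ennreal e"
      using e by (simp flip: ennreal_mult ennreal_plus del: ennreal_numeral)
    finally show "?Q (\<lambda>x. f x + g x) + ?Q (\<lambda>x. f x - g x) \<le> 2 * ?Q f + 2 * ?Q g + ennreal e" .
  qed
  have "?Q (\<lambda>x. f x + g x) + ?Q (\<lambda>x. f x - g x) = 2 * ?Q f + 2 * ?Q g"
    if f: "f \<in> borel_measurable M" and g: "g \<in> borel_measurable M" for f g :: "'a \<Rightarrow> real"
  proof (rule antisym[OF le[OF f g]])
    have "?Q (\<lambda>x. 2 * f x) + ?Q (\<lambda>x. 2 * g x) \<le> 2 * ?Q (\<lambda>x. f x + g x) + 2 * ?Q (\<lambda>x. f x - g x)"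
      using le[of "\<lambda>x. f x + g x" "\<lambda>x. f x - g x"] f g by (simp flip: mult_2)
    then have "2 * (2 * ?Q f + 2 * ?Q g) \<le> 2 * (?Q (\<lambda>x. f x + g x) + ?Q (\<lambda>x. f x - g x))"
      using scale[OF f, of 2] scale[OF g, of 2] by (simp add: distrib_left flip: mult.assoc)
    then show "2 * ?Q f + 2 * ?Q g \<le> ?Q (\<lambda>x. f x + g x) + ?Q (\<lambda>x. f x - g x)"
      by (subst (asm) ennreal_mult_le_mult_iff) auto
  qed
  with scale show ?thesis unfolding quadratic_functional_def by blast
qed

text \<open>For a nonnegative weight this is the square of the weighted L2 norm, possibly
  infinite.\<close>

definition wnorm :: "'a measure \<Rightarrow> ('a \<Rightarrow> real) \<Rightarrow> ('a \<Rightarrow> real) \<Rightarrow> ennreal" where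
  "wnorm M w f = (\<integral>\<^sup>+x. ennreal (w x * (f x)\<^sup>2) \<partial>M)"

lemma quadratic_functional_wnorm:
  assumes [measurable]: "w \<in> borel_measurable M" and w: "\<And>x. 0 \<le> w x"
  shows "quadratic_functional M (wnorm M w)"
  unfolding quadratic_functional_def
proof (intro conjI ballI allI)
  fix f g :: "'a \<Rightarrow> real" and c :: real
  assume [measurable]: "f \<in> borel_measurable M"
  show "wnorm M w (\<lambda>x. c * f x) = ennreal (c\<^sup>2) * wnorm M w f"
    unfolding wnorm_def using w
    by (subst nn_integral_cmult[symmetric])
      (auto simp: power_mult_distrib mult_ac simp flip: ennreal_mult)
  assume [measurable]: "g \<in> borel_measurable M"
  have "wnorm M w (\<lambda>x. f x + g x) + wnorm M w (\<lambda>x. f x - g x)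
    = (\<integral>\<^sup>+x. ennreal (w x * (f x + g x)\<^sup>2) + ennreal (w x * (f x - g x)\<^sup>2) \<partial>M)"
    unfolding wnorm_def by (rule nn_integral_add[symmetric]) auto
  also have "\<dots> = (\<integral>\<^sup>+x. ennreal 2 * ennreal (w x * (f x)\<^sup>2) + ennreal 2 * ennreal (w x * (g x)\<^sup>2) \<partial>M)"
  proof (rule nn_integral_cong)
    fix x
    have "w x * (f x + g x)\<^sup>2 + w x * (f x - g x)\<^sup>2 = 2 * (w x * (f x)\<^sup>2) + 2 * (w x * (g x)\<^sup>2)"
      by (simp add: power2_sum power2_diff algebra_simps)
    then show "ennreal (w x * (f x + g x)\<^sup>2) + ennreal (w x * (f x - g x)\<^sup>2)
      = ennreal 2 * ennreal (w x * (f x)\<^sup>2) + ennreal 2 * ennreal (w x * (g x)\<^sup>2)"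
      using w[of x] by (simp flip: ennreal_mult ennreal_plus del: ennreal_numeral)
  qed
  also have "\<dots> = 2 * wnorm M w f + 2 * wnorm M w g"
    unfolding wnorm_def by (subst nn_integral_add) (auto simp: nn_integral_cmult)
  finally show "wnorm M w (\<lambda>x. f x + g x) + wnorm M w (\<lambda>x. f x - g x) = 2 * wnorm M w f + 2 * wnorm M w g" .
qed

lemma wnorm_mono:
  assumes "\<And>x. 0 \<le> w x" "\<And>x. x \<in> space M \<Longrightarrow> \<bar>f x\<bar> \<le> \<bar>g x\<bar>"
  shows "wnorm M w f \<le> wnorm M w g"
  unfolding wnorm_def using assms
  by (intro nn_integral_mono ennreal_leI mult_left_mono) (auto simp: abs_le_square_iff)

lemma quadratic_functional_form:
  assumes "quadratic_form M E"
  shows "quadratic_functional M (\<lambda>f. E (L0_class M f))"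
  unfolding quadratic_functional_def
proof (intro conjI ballI allI)
  fix f g :: "'a \<Rightarrow> real" and c :: real
  assume f: "f \<in> borel_measurable M"
  show "E (L0_class M (\<lambda>x. c * f x)) = ennreal (c\<^sup>2) * E (L0_class M f)"
    using assms L0_class_mem[OF f] unfolding quadratic_form_def
    by (simp add: L0_scale_class[OF f, symmetric])
  assume g: "g \<in> borel_measurable M"
  show "E (L0_class M (\<lambda>x. f x + g x)) + E (L0_class M (\<lambda>x. f x - g x)) =
    2 * E (L0_class M f) + 2 * E (L0_class M g)"
    using assms L0_class_mem[OF f] L0_class_mem[OF g] unfolding quadratic_form_def
    by (simp add: L0_add_class[OF f g, symmetric] L0_diff_class[OF f g, symmetric])
qed

lemma borel_measurable_normal_contraction_real:
  assumes "normal_contraction_real C"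
  shows "C \<in> borel_measurable borel"
  using borel_measurable_normal_contraction[of 1 "\<lambda>x. C (x 0)" "\<lambda>_ x. x" borel] assms
  by (simp add: normal_contraction_real_iff)

text \<open>
  Because \<open>C\<close> acts pointwise, \<open>C \<circ> u\<close> competes in the infimum for \<open>C \<circ> f\<close> whenever \<open>u\<close> competes in
  the one for \<open>f\<close>.
\<close>

lemma inf_conv_normal_contraction:
  fixes f :: "'a \<Rightarrow> real"
  assumes C: "normal_contraction_real C" and w: "\<And>x. 0 \<le> w x"
    and p: "\<And>u :: 'a \<Rightarrow> real. u \<in> borel_measurable M \<Longrightarrow> p (\<lambda>x. C (u x)) \<le> p u"
  shows "inf_conv M p (wnorm M w) (\<lambda>x. C (f x)) \<le> inf_conv M p (wnorm M w) f"
  unfolding inf_conv_def[of _ _ _ f]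
proof (rule INF_greatest)
  fix u :: "'a \<Rightarrow> real" assume u: "u \<in> borel_measurable M"
  then have Cu: "(\<lambda>x. C (u x)) \<in> borel_measurable M"
    using borel_measurable_normal_contraction_real[OF C] by (rule measurable_compose)
  have "inf_conv M p (wnorm M w) (\<lambda>x. C (f x)) \<le> p (\<lambda>x. C (u x)) + wnorm M w (\<lambda>x. C (u x) - C (f x))"
    by (rule inf_conv_lower[OF Cu])
  also have "\<dots> \<le> p u + wnorm M w (\<lambda>x. u x - f x)"
    using C by (intro add_mono p u wnorm_mono w) (auto simp: normal_contraction_real_def)
  finally show "inf_conv M p (wnorm M w) (\<lambda>x. C (f x)) \<le> p u + wnorm M w (\<lambda>x. u x - f x)" .
qed


section \<open>Approximation by step functions\<close>

text \<open>
  Evaluating at a representative \<open>r\<close> of each cell of the partition by \<open>T\<close>, and taking the value \<open>0\<close>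
  off finitely many cells, preserves the pointwise hypotheses relating the functions \<open>G k\<close>.
\<close>

lemma step_approximation:
  fixes G :: "nat \<Rightarrow> 'a \<Rightarrow> real"
  assumes G: "\<And>k. k \<le> n \<Longrightarrow> G k \<in> borel_measurable M"
    and w[measurable]: "w \<in> borel_measurable M" and w_nonneg: "\<And>x. 0 \<le> w x"
    and h[measurable]: "h \<in> borel_measurable M" and h1: "\<And>x. 1 \<le> h x"
    and Gh: "\<And>k x. k \<le> n \<Longrightarrow> x \<in> space M \<Longrightarrow> \<bar>G k x\<bar> \<le> h x"
    and fin: "wnorm M w h < \<infinity>" and e: "(0 :: ennreal) < e"
  obtains T :: "'a \<Rightarrow> nat \<Rightarrow> int" and I r where
    "finite I" "\<forall>i\<in>I. r i \<in> space M"
    "\<forall>i. (\<lambda>x. of_bool (T x = i) :: real) \<in> borel_measurable M"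
    "\<forall>k\<le>n. wnorm M w (\<lambda>x. G k x - (\<Sum>i\<in>I. G k (r i) * of_bool (T x = i))) < e"
proof -
  \<comment> \<open>A cell fixes the floors of all \<open>N * G k\<close> at once, so each
    \<open>G k\<close> varies by at most \<open>1 / N\<close> on it. The value 0 beyond
    \<open>n\<close> keeps the set of labels of bounded functions finite.\<close>
  define T where "T N x = (\<lambda>k. if k \<le> n then \<lfloor>real N * G k x\<rfloor> else 0)" for N x
  define I where "I N = T N ` {x \<in> space M. \<forall>k\<le>n. \<bar>G k x\<bar> \<le> real N}" for N
  define r where "r N i = (SOME x. x \<in> space M \<and> T N x = i)" for N i
  define A where "A N k x = (\<Sum>i\<in>I N. G k (r N i) * of_bool (T N x = i))" for N k x
  have fin_I: "finite (I N)" for N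
  proof (rule finite_subset)
    show "I N \<subseteq> {i. \<forall>k. (k \<in> {..n} \<longrightarrow> i k \<in> {- int (N * N)..int (N * N)}) \<and> (k \<notin> {..n} \<longrightarrow> i k = 0)}"
    proof (clarsimp simp: I_def T_def)
      fix x k assume "\<forall>k\<le>n. \<bar>G k x\<bar> \<le> real N" "k \<le> n"
      then have "\<bar>real N * G k x\<bar> \<le> real N * real N"
        by (auto simp: abs_mult intro!: mult_left_mono)
      then show "- (int N * int N) \<le> \<lfloor>real N * G k x\<rfloor> \<and> \<lfloor>real N * G k x\<rfloor> \<le> int N * int N"
        by (auto simp: le_floor_iff floor_le_iff abs_le_iff)
    qed
  qed (rule finite_set_of_finite_funs; simp)
  have r: "r N i \<in> space M \<and> T N (r N i) = i" if "i \<in> I N" for N i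
    using that unfolding r_def I_def by (intro someI_ex[of "\<lambda>x. x \<in> space M \<and> T N x = i"]) blast
  have T_meas: "(\<lambda>x. of_bool (T N x = i) :: real) \<in> borel_measurable M" for N i
  proof -
    have "Measurable.pred M (\<lambda>x. \<lfloor>real N * G k x\<rfloor> = i k)" if "k \<le> n" for k
    proof -
      note [measurable] = G[OF that]
      show ?thesis unfolding floor_eq_iff by measurable
    qed
    then have "{x \<in> space M. (\<forall>k\<in>{..n}. \<lfloor>real N * G k x\<rfloor> = i k) \<and> (\<forall>k>n. i k = 0)} \<in> sets M"
      by (intro sets.sets_Collect_conj sets.sets_Collect_finite_All sets.sets_Collect_const)
        (auto simp: pred_def)
    moreover have "T N x = i \<longleftrightarrow> (\<forall>k\<in>{..n}. \<lfloor>real N * G k x\<rfloor> = i k) \<and> (\<forall>k>n. i k = 0)" for x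
      unfolding T_def fun_eq_iff by (metis atMost_iff not_le)
    ultimately have [measurable]: "Measurable.pred M (\<lambda>x. T N x = i)"
      by (simp add: pred_def)
    show ?thesis unfolding of_bool_def by measurable
  qed
  have A_eq: "A N k x = (if T N x \<in> I N then G k (r N (T N x)) else 0)" for N k x
    unfolding A_def using fin_I by (simp add: of_bool_def if_distrib cong: if_cong)
  have close: "\<bar>G k x - A N k x\<bar> \<le> 1 / real N"
    if "k \<le> n" "T N x \<in> I N" "0 < N" for k x N
  proof -
    let ?y = "r N (T N x)"
    have "T N ?y k = T N x k" using r[OF that(2)] by simp
    then have "\<lfloor>real N * G k ?y\<rfloor> = \<lfloor>real N * G k x\<rfloor>" using that(1) by (simp add: T_def)
    then have "\<bar>real N * G k x - real N * G k ?y\<bar> \<le> 1" by linarith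
    then have "real N * \<bar>G k x - G k ?y\<bar> \<le> 1" by (simp add: abs_mult flip: right_diff_distrib)
    then show ?thesis using that by (simp add: A_eq field_simps)
  qed
  \<comment> \<open>This gives the dominating function for the limit below: on the chosen cells the
    error is at most 1, elsewhere the approximation is 0 and the error is at most
    \<open>h x\<close>.\<close>
  have bound: "\<bar>G k x - A N k x\<bar> \<le> 2 * h x" if "k \<le> n" "x \<in> space M" "0 < N" for k x N
  proof (cases "T N x \<in> I N")
    case True
    have "1 / real N \<le> 1" using that(3) by simp
    then show ?thesis using close[OF that(1) True that(3)] h1[of x] by linarith
  next
    case False
    then show ?thesis using Gh[OF that(1,2)] h1[of x] by (simp add: A_eq)
  qed
  \<comment> \<open>Once \<open>Suc N\<close> exceeds \<open>h x\<close>, the cell of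
    \<open>x\<close> is among the chosen ones and \<open>close\<close> applies; the successor avoids
    division by 0.\<close>
  have lim: "(\<lambda>N. A (Suc N) k x) \<longlonglongrightarrow> G k x" if "k \<le> n" "x \<in> space M" for k x
  proof -
    have "\<forall>\<^sub>F N in sequentially. norm (G k x - A (Suc N) k x) \<le> 1 / real (Suc N)"
      using eventually_ge_at_top[of "nat \<lceil>h x\<rceil>"]
    proof eventually_elim
      case (elim N)
      then have hN: "h x \<le> real (Suc N)" by linarith
      have "\<bar>G j x\<bar> \<le> real (Suc N)" if "j \<le> n" for j
        using Gh[OF that \<open>x \<in> space M\<close>] hN by linarith
      then have "T (Suc N) x \<in> I (Suc N)"
        unfolding I_def using that(2) by blast
      then show ?case using close[OF that(1), of "Suc N" x] by simp
    qed
    then have "(\<lambda>N. G k x - A (Suc N) k x) \<longlonglongrightarrow> 0"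
      by (rule Lim_null_comparison) (rule LIMSEQ_Suc[OF lim_1_over_n])
    then have "(\<lambda>N. G k x - (G k x - A (Suc N) k x)) \<longlonglongrightarrow> G k x - 0"
      by (intro tendsto_diff tendsto_const)
    then show ?thesis by simp
  qed
  have "\<forall>\<^sub>F N in sequentially. wnorm M w (\<lambda>x. G k x - A (Suc N) k x) < e" if k: "k \<le> n" for k
  proof -
    note [measurable] = G[OF k]
    have [measurable]: "A N k \<in> borel_measurable M" for N
      unfolding A_def by (intro borel_measurable_sum borel_measurable_times borel_measurable_const T_meas)
    have "(\<lambda>N. \<integral>\<^sup>+x. ennreal (w x * (G k x - A (Suc N) k x)\<^sup>2) \<partial>M) \<longlonglongrightarrow> (\<integral>\<^sup>+x. 0 \<partial>M)"
    proof (rule nn_integral_dominated_convergence)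
      show "AE x in M. ennreal (w x * (G k x - A (Suc N) k x)\<^sup>2) \<le> ennreal (w x * (2 * h x)\<^sup>2)" for N
      proof (rule AE_I2)
        fix x assume x: "x \<in> space M"
        have "\<bar>G k x - A (Suc N) k x\<bar> \<le> \<bar>2 * h x\<bar>"
          using bound[OF k x] h1[of x] by simp
        then show "ennreal (w x * (G k x - A (Suc N) k x)\<^sup>2) \<le> ennreal (w x * (2 * h x)\<^sup>2)"
          using w_nonneg by (intro ennreal_leI mult_left_mono) (auto simp: abs_le_square_iff)
      qed
      have "wnorm M w (\<lambda>x. 2 * h x) = ennreal (2\<^sup>2) * wnorm M w h"
        using quadratic_functional_wnorm[OF w w_nonneg] h unfolding quadratic_functional_def by blast
      then show "(\<integral>\<^sup>+x. ennreal (w x * (2 * h x)\<^sup>2) \<partial>M) < \<infinity>"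
        using fin by (simp add: wnorm_def ennreal_mult_less_top)
      show "AE x in M. (\<lambda>N. ennreal (w x * (G k x - A (Suc N) k x)\<^sup>2)) \<longlonglongrightarrow> 0"
      proof (rule AE_I2)
        fix x assume "x \<in> space M"
        then have "(\<lambda>N. ennreal (w x * (G k x - A (Suc N) k x)\<^sup>2)) \<longlonglongrightarrow> ennreal (w x * (G k x - G k x)\<^sup>2)"
          using lim[OF k] by (intro tendsto_intros)
        then show "(\<lambda>N. ennreal (w x * (G k x - A (Suc N) k x)\<^sup>2)) \<longlonglongrightarrow> 0" by simp
      qed
    qed auto
    then show ?thesis
      using e by (intro order_tendstoD(2)) (auto simp: wnorm_def)
  qed
  then have "\<forall>\<^sub>F N in sequentially. \<forall>k\<in>{..n}. wnorm M w (\<lambda>x. G k x - A (Suc N) k x) < e"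
    by (intro eventually_ball_finite) auto
  then obtain N where "\<And>k. k \<le> n \<Longrightarrow> wnorm M w (\<lambda>x. G k x - A (Suc N) k x) < e"
    by (force simp: eventually_sequentially)
  with fin_I[of "Suc N"] r[of _ "Suc N"] T_meas[of "Suc N"] show thesis
    unfolding A_def by (intro that[of "I (Suc N)" "r (Suc N)" "T (Suc N)"]) auto
qed

text \<open>The regularised form is Markovian and at most \<open>wnorm M w\<close>. So approximation
  in the weighted L2 norm is approximation in energy, and the inequality passes from step functions
  to the limit. Functions dominated by \<open>h\<close> have finite energy.\<close>

lemma inf_conv_contraction:
  fixes p :: "('a \<Rightarrow> real) \<Rightarrow> ennreal" and g :: "'a \<Rightarrow> real" and gs :: "nat \<Rightarrow> 'a \<Rightarrow> real"
  assumes p: "quadratic_functional M p"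
    and markov: "\<And>\<epsilon>. 0 < \<epsilon> \<Longrightarrow> \<exists>C. cutoff \<epsilon> C \<and> (\<forall>u\<in>borel_measurable M. p (\<lambda>x. C (u x)) \<le> p u)"
    and w: "w \<in> borel_measurable M" "\<And>x. 0 \<le> w x"
    and h: "h \<in> borel_measurable M" "\<And>x. 1 \<le> h x" and fin: "wnorm M w h < \<infinity>"
    and g: "g \<in> borel_measurable M" "\<And>x. x \<in> space M \<Longrightarrow> \<bar>g x\<bar> \<le> h x"
    and gs: "\<And>k. k < n \<Longrightarrow> gs k \<in> borel_measurable M"
      "\<And>k x. k < n \<Longrightarrow> x \<in> space M \<Longrightarrow> \<bar>gs k x\<bar> \<le> h x"
    and val: "\<And>x. x \<in> space M \<Longrightarrow> \<bar>g x\<bar> \<le> (\<Sum>k<n. \<bar>gs k x\<bar>)"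
    and diff: "\<And>x y. x \<in> space M \<Longrightarrow> y \<in> space M \<Longrightarrow> \<bar>g x - g y\<bar> \<le> (\<Sum>k<n. \<bar>gs k x - gs k y\<bar>)"
  shows "sqrt (enn2real (inf_conv M p (wnorm M w) g))
    \<le> (\<Sum>k<n. sqrt (enn2real (inf_conv M p (wnorm M w) (gs k))))"
proof -
  let ?Q = "inf_conv M p (wnorm M w)"
  define V where "V = {f \<in> borel_measurable M. ?Q f < \<infinity>}"
  define q where "q f = enn2real (?Q f)" for f
  note wn = quadratic_functional_wnorm[OF w]
  interpret quadratic_space V q
    unfolding V_def q_def
    by (rule quadratic_space_quadratic_functional[OF quadratic_functional_inf_conv[OF p wn]])
  interpret markovian_quadratic_space V q
  proof
    fix \<epsilon> :: real assume "0 < \<epsilon>"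
    then obtain C where C: "cutoff \<epsilon> C" "\<And>u. u \<in> borel_measurable M \<Longrightarrow> p (\<lambda>x. C (u x)) \<le> p u"
      using markov by blast
    then have C': "normal_contraction_real C" by (simp add: cutoff_def)
    have "(\<lambda>x. C (f x)) \<in> V \<and> q (\<lambda>x. C (f x)) \<le> q f" if "f \<in> V" for f
      using that inf_conv_normal_contraction[of C w M p f, OF C' w(2) C(2)]
        measurable_compose[OF _ borel_measurable_normal_contraction_real[OF C'], of f M]
      by (auto simp: V_def q_def intro: enn2real_mono)
    with C(1) show "\<exists>C. cutoff \<epsilon> C \<and> (\<forall>f\<in>V. (\<lambda>x. C (f x)) \<in> V \<and> q (\<lambda>x. C (f x)) \<le> q f)"
      by blast
  qed
  have le_wn: "?Q f \<le> wnorm M w f" if "f \<in> borel_measurable M" for f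
    using that by (rule inf_conv_le_right[OF p wn])
  have V_bounded: "f \<in> V" if f: "f \<in> borel_measurable M" "\<And>x. x \<in> space M \<Longrightarrow> \<bar>f x\<bar> \<le> h x" for f
  proof -
    have "\<bar>f x\<bar> \<le> \<bar>h x\<bar>" if "x \<in> space M" for x
      using f(2)[OF that] by linarith
    then have "?Q f \<le> wnorm M w h"
      using le_wn[OF f(1)] wnorm_mono[OF w(2), of M f h] by (meson order_trans)
    with fin f(1) show ?thesis by (simp add: V_def)
  qed
  \<comment> \<open>Placing \<open>g\<close> at index \<open>n\<close> lets a single partition
    approximate all the functions simultaneously, as needed to transfer \<open>val\<close> and
    \<open>diff\<close>.\<close>
  define G where "G k = (if k < n then gs k else g)" for k
  have G_meas: "G k \<in> borel_measurable M" for k using g gs by (simp add: G_def)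
  have G_h: "\<bar>G k x\<bar> \<le> h x" if "x \<in> space M" for k x using g gs that by (simp add: G_def)
  have "sqrt (q g) \<le> (\<Sum>k<n. sqrt (q (gs k))) + \<delta>" if "0 < \<delta>" for \<delta>
  proof -
    \<comment> \<open>There are \<open>n\<close> errors from the \<open>gs k\<close> and one from
      \<open>g\<close>, in total \<open>\<delta>\<close>.\<close>
    define \<eta> where "\<eta> = \<delta> / real (Suc n)"
    have "0 < \<eta>" using \<open>0 < \<delta>\<close> by (simp add: \<eta>_def)
    then have e: "0 < ennreal (\<eta>\<^sup>2)" by simp
    obtain T :: "'a \<Rightarrow> nat \<Rightarrow> int" and I r where
      I: "finite I" and "\<forall>i\<in>I. r i \<in> space M"
      and "\<forall>i. (\<lambda>x. of_bool (T x = i) :: real) \<in> borel_measurable M"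
      and "\<forall>k\<le>n. wnorm M w (\<lambda>x. G k x - (\<Sum>i\<in>I. G k (r i) * of_bool (T x = i))) < ennreal (\<eta>\<^sup>2)"
      by (rule step_approximation[where n = n and G = G, OF G_meas w h G_h fin e]) (assumption, rule that)
    then have r: "r i \<in> space M" if "i \<in> I" for i using that by blast
    have T: "(\<lambda>x. of_bool (T x = i) :: real) \<in> borel_measurable M" for i
      using \<open>\<forall>i. _ \<in> borel_measurable M\<close> by blast
    have close: "wnorm M w (\<lambda>x. G k x - (\<Sum>i\<in>I. G k (r i) * of_bool (T x = i))) < ennreal (\<eta>\<^sup>2)"
      if "k \<le> n" for k
      using \<open>\<forall>k\<le>n. _ < _\<close> that by blast
    define A where "A k x = (\<Sum>i\<in>I. G k (r i) * of_bool (T x = i))" for k x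
    have T_V: "(\<lambda>x. of_bool (T x = i)) \<in> V" for i
    proof (intro V_bounded T)
      show "\<bar>of_bool (T x = i)\<bar> \<le> h x" for x using h(2)[of x] by (simp add: of_bool_def)
    qed
    have A_V: "A k \<in> V" for k
      unfolding A_def[abs_def] by (intro V_sum V_scale T_V)
    have G_V: "G k \<in> V" for k by (intro V_bounded G_meas G_h)
    have A_eq: "(\<lambda>x. G k x - (\<Sum>i\<in>I. G k (r i) * of_bool (T x = i))) = (\<lambda>x. G k x - A k x)" for k
      by (simp only: A_def)
    have small: "sqrt (q (\<lambda>x. G k x - A k x)) \<le> \<eta>" "sqrt (q (\<lambda>x. A k x - G k x)) \<le> \<eta>" if "k \<le> n" for k
    proof -
      have "?Q (\<lambda>x. G k x - A k x) \<le> wnorm M w (\<lambda>x. G k x - A k x)"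
        using V_diff[OF G_V A_V] by (intro le_wn) (simp add: V_def)
      also have "\<dots> \<le> ennreal (\<eta>\<^sup>2)"
        using close[OF that] by (simp add: A_eq)
      finally have "?Q (\<lambda>x. G k x - A k x) \<le> ennreal (\<eta>\<^sup>2)" .
      then have "q (\<lambda>x. G k x - A k x) \<le> \<eta>\<^sup>2"
        unfolding q_def by (auto intro: enn2real_leI)
      then show *: "sqrt (q (\<lambda>x. G k x - A k x)) \<le> \<eta>"
        using \<open>0 < \<eta>\<close> by (simp add: real_le_lsqrt)
      show "sqrt (q (\<lambda>x. A k x - G k x)) \<le> \<eta>"
        using * q_minus[OF V_diff[OF G_V A_V], of k k] by simp
    qed
    have "sqrt (q (A n)) \<le> (\<Sum>k<n. sqrt (q (A k)))"
      unfolding A_def[abs_def]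
      by (rule step_functions_contraction[OF I T_V])
        (use val[OF r] diff[OF r r] in \<open>auto simp: G_def\<close>)
    also have "\<dots> \<le> (\<Sum>k<n. sqrt (q (gs k)) + \<eta>)"
    proof (rule sum_mono)
      fix k assume "k \<in> {..<n}"
      then show "sqrt (q (A k)) \<le> sqrt (q (gs k)) + \<eta>"
        using q_triangle_diff[OF A_V G_V, of k k] small(2)[of k] by (simp add: G_def)
    qed
    also have "\<dots> = (\<Sum>k<n. sqrt (q (gs k))) + real n * \<eta>"
      by (simp add: sum.distrib)
    finally have "sqrt (q g) \<le> (\<Sum>k<n. sqrt (q (gs k))) + real n * \<eta> + \<eta>"
      using q_triangle_diff[OF G_V A_V, of n n] small(1)[of n] by (simp add: G_def)
    moreover have "real n * \<eta> + \<eta> = real (Suc n) * \<eta>" by (simp add: distrib_right)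
    moreover have "\<dots> = \<delta>" by (simp add: \<eta>_def)
    ultimately show ?thesis by simp
  qed
  then show ?thesis unfolding q_def by (rule field_le_epsilon)
qed


section \<open>Local convergence in measure and completeness\<close>

lemma L0_class_of_mem:
  assumes "u \<in> L0 M" "g \<in> u"
  shows "g \<in> borel_measurable M" "u = L0_class M g"
proof -
  obtain f where f: "f \<in> borel_measurable M" "u = L0_class M f"
    using assms(1) by (auto simp: L0_def L0_class_def quotient_def)
  with assms(2) L0_classD[of g M f] L0_class_eqI[of f M g]
  show "g \<in> borel_measurable M" "u = L0_class M g" by simp_all
qed

lemma L0_cases:
  assumes "u \<in> L0 M"
  obtains f where "f \<in> borel_measurable M" "u = L0_class M f"
  using assms by (auto simp: L0_def L0_class_def quotient_def)

lemma sqrt_ennreal_less_iff: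
  assumes "0 < r"
  shows "sqrt_ennreal a < ennreal r \<longleftrightarrow> a < ennreal (r\<^sup>2)"
proof (cases a)
  case (real x)
  have "sqrt x < r \<longleftrightarrow> x < r\<^sup>2"
    using assms real by (metis less_imp_le real_sqrt_abs abs_of_pos real_sqrt_less_iff)
  with real assms show ?thesis by (simp add: sqrt_ennreal_def ennreal_less_iff)
qed (simp add: sqrt_ennreal_def)

lemma sqrt_ennreal_mono_iff: "sqrt_ennreal a \<le> sqrt_ennreal b \<longleftrightarrow> a \<le> b"
  by (cases a; cases b) (auto simp: sqrt_ennreal_def top_unique)

definition local_measure_dist :: "'a measure \<Rightarrow> 'a set \<Rightarrow> ('a \<Rightarrow> real) \<Rightarrow> ennreal" where
  "local_measure_dist M U f = (\<integral>\<^sup>+x\<in>U. ennreal (min \<bar>f x\<bar> 1) \<partial>M)"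

lemma local_measure_dist_triangle:
  assumes [measurable]: "U \<in> sets M" "f \<in> borel_measurable M" "g \<in> borel_measurable M"
  shows "local_measure_dist M U (\<lambda>x. f x - g x) \<le> local_measure_dist M U f + local_measure_dist M U g"
proof -
  have "local_measure_dist M U (\<lambda>x. f x - g x)
    \<le> (\<integral>\<^sup>+x. ennreal (min \<bar>f x\<bar> 1) * indicator U x + ennreal (min \<bar>g x\<bar> 1) * indicator U x \<partial>M)"
    unfolding local_measure_dist_def
    by (intro nn_integral_mono) (auto simp: indicator_def simp flip: ennreal_plus intro!: ennreal_leI)
  also have "\<dots> = local_measure_dist M U f + local_measure_dist M U g"
    unfolding local_measure_dist_def by (rule nn_integral_add) auto
  finally show ?thesis .
qed

text \<open>Every subset of finite measure of the set where \<open>f\<close> and \<open>g\<close>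
  differ is null. Semifiniteness then excludes infinite measure of that set, so limits of local
  convergence in measure are unique up to null sets.\<close>

lemma AE_eq_if_local_measure_dist_zero:
  assumes "semifinite M" and [measurable]: "f \<in> borel_measurable M" "g \<in> borel_measurable M"
    and zero: "\<And>U. U \<in> sets M \<Longrightarrow> emeasure M U < \<infinity> \<Longrightarrow> local_measure_dist M U (\<lambda>x. f x - g x) = 0"
  shows "AE x in M. f x = g x"
proof -
  define N where "N = {x \<in> space M. f x \<noteq> g x}"
  have N: "N \<in> sets M" unfolding N_def by measurable
  have null: "emeasure M U = 0" if U[measurable]: "U \<in> sets M" "U \<subseteq> N" "emeasure M U < \<infinity>" for U
  proof -
    have "AE x in M. ennreal (min \<bar>f x - g x\<bar> 1) * indicator U x = 0"
      using zero[OF that(1,3)] unfolding local_measure_dist_def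
      by (subst (asm) nn_integral_0_iff_AE) auto
    then have "AE x in M. x \<notin> U"
    proof eventually_elim
      case (elim x)
      then show ?case
        using \<open>U \<subseteq> N\<close> by (auto simp: N_def indicator_def min_def split: if_splits)
    qed
    then show ?thesis using U(1) by (simp add: AE_iff_measurable[of U M] sets.sets_into_space[THEN subsetD] Collect_conj_eq Int_absorb1 cong: conj_cong)
  qed
  have "emeasure M N = 0"
  proof (rule ccontr)
    assume "emeasure M N \<noteq> 0"
    then have "emeasure M N = \<infinity>"
      using null[OF N] by (metis infinity_ennreal_def order_refl top.not_eq_extremum)
    then obtain B where "B \<in> sets M" "B \<subseteq> N" "0 < emeasure M B" "emeasure M B < \<infinity>"
      using \<open>semifinite M\<close> N unfolding semifinite_def by blast
    with null[of B] show False by simp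
  qed
  with N show ?thesis
    by (intro AE_I[of _ _ N]) (auto simp: N_def)
qed

text \<open>It suffices to test subbasic sets: finite intersections preserve eventual membership,
  and for a union one member containing \<open>z\<close> is enough.\<close>

lemma eventually_topology_generated_by:
  assumes "openin (topology_generated_by S) N" "z \<in> N"
    and "\<And>A. A \<in> S \<Longrightarrow> z \<in> A \<Longrightarrow> \<forall>\<^sub>F x in G. \<phi> x \<in> A"
  shows "\<forall>\<^sub>F x in G. \<phi> x \<in> N"
  using openin_topology_generated_by[OF assms(1)] assms(2)
proof induction
  case (Int a b)
  then show ?case by (simp add: eventually_conj)
next
  case (UN K)
  then obtain k where "k \<in> K" "\<forall>\<^sub>F x in G. \<phi> x \<in> k" by blast
  then show ?case by (auto elim: eventually_mono)
qed (use assms(3) in auto)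

lemma ennreal_less_add_obtain:
  assumes "a < ennreal r"
  obtains s where "0 < s" "\<forall>b<ennreal s. b + a < ennreal r"
proof -
  from assms obtain x where a: "a = ennreal x" "0 \<le> x"
    by (cases a) auto
  with assms have "x < r" by (simp add: ennreal_less_iff)
  show thesis
  proof
    show "0 < r - x" using \<open>x < r\<close> by simp
    have "b + a < ennreal r" if "b < ennreal (r - x)" for b
      using that a \<open>x < r\<close> by (cases b) (auto simp: ennreal_less_iff simp flip: ennreal_plus)
    then show "\<forall>b<ennreal (r - x). b + a < ennreal r" by blast
  qed
qed

text \<open>Completeness speaks of filters of classes and of a generated topology. Here it becomes a
  criterion for filters of functions, by pushing \<open>F\<close> forward along
  \<open>L0_class\<close> and checking neighbourhoods of zero on the subbasis.\<close>

lemma closed_form_limit: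
  assumes closed: "closed_form M E" and "F \<noteq> bot"
    and dom: "\<forall>\<^sub>F u in F. u \<in> borel_measurable M \<and> E (L0_class M u) < \<infinity>"
    and cauchy_meas: "\<And>U r. U \<in> sets M \<Longrightarrow> emeasure M U < \<infinity> \<Longrightarrow> 0 < r \<Longrightarrow>
      \<forall>\<^sub>F (u, v) in F \<times>\<^sub>F F. local_measure_dist M U (\<lambda>x. u x - v x) < ennreal r"
    and cauchy_form: "\<And>r. 0 < r \<Longrightarrow> \<forall>\<^sub>F (u, v) in F \<times>\<^sub>F F. E (L0_class M (\<lambda>x. u x - v x)) < ennreal r"
  obtains f where "f \<in> borel_measurable M" "E (L0_class M f) < \<infinity>"
    "\<And>U r. U \<in> sets M \<Longrightarrow> emeasure M U < \<infinity> \<Longrightarrow> 0 < r \<Longrightarrow>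
      \<forall>\<^sub>F u in F. local_measure_dist M U (\<lambda>x. u x - f x) < ennreal r"
    "\<And>r. 0 < r \<Longrightarrow> \<forall>\<^sub>F u in F. E (L0_class M (\<lambda>x. u x - f x)) < ennreal r"
proof -
  let ?D = "form_domain M E" and ?T = "form_topology M E" and ?c = "L0_class M"
  have form: "quadratic_form M E" using closed by (simp add: closed_form_def)
  define V where "V = {f \<in> borel_measurable M. E (?c f) < \<infinity>}"
  define q where "q f = enn2real (E (?c f))" for f
  interpret quadratic_space V q
    unfolding V_def q_def
    by (rule quadratic_space_quadratic_functional[OF quadratic_functional_form[OF form]])
  have sqrt_E: "sqrt_ennreal (E (?c f)) = ennreal (sqrt (q f))" if "f \<in> V" for f
    using that by (auto simp: V_def q_def sqrt_ennreal_def)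
  have V_D: "?c f \<in> ?D" if "f \<in> V" for f
    using that by (simp add: V_def form_domain_def L0_class_mem)
  have D_V: "\<exists>f\<in>V. u = ?c f" if "u \<in> ?D" for u
    using that by (auto simp: V_def form_domain_def elim: L0_cases)
  have dom2: "\<forall>\<^sub>F z in F \<times>\<^sub>F F. fst z \<in> V \<and> snd z \<in> V"
    using dom unfolding eventually_prod_same V_def by (force intro!: exI[of _ "\<lambda>u. u \<in> borel_measurable M \<and> E (?c u) < \<infinity>"])
  let ?\<phi> = "\<lambda>z. ?c (\<lambda>x. fst z x - snd z x)"
  have cauchy_L0: "\<forall>\<^sub>F z in F \<times>\<^sub>F F. ?\<phi> z \<in> W"
    if "openin (L0_topology M) W" "L0_zero M \<in> W" for W
    using that unfolding L0_topology_def
  proof (rule eventually_topology_generated_by)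
    fix A assume "A \<in> {{v \<in> L0 M. L0_gauge M U (L0_diff M v u) < ennreal r} | U u r.
        U \<in> sets M \<and> emeasure M U < \<infinity> \<and> u \<in> L0 M \<and> 0 < r}"
    then obtain U u r where A: "A = {v \<in> L0 M. L0_gauge M U (L0_diff M v u) < ennreal r}"
      and U: "U \<in> sets M" "emeasure M U < \<infinity>" and u: "u \<in> L0 M" by blast
    obtain f where f[measurable]: "f \<in> borel_measurable M" and uf: "u = ?c f"
      using L0_cases[OF u] .
    have in_A: "?c g \<in> A \<longleftrightarrow> local_measure_dist M U (\<lambda>x. g x - f x) < ennreal r"
      if "g \<in> borel_measurable M" for g
      using that f by (simp add: A uf L0_class_mem L0_diff_class L0_gauge_class local_measure_dist_def)
    assume "L0_zero M \<in> A"
    then have "local_measure_dist M U f < ennreal r"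
      using in_A[of "\<lambda>x. 0"] by (simp add: L0_zero_def local_measure_dist_def)
    \<comment> \<open>A subbasic set containing zero is a ball about some \<open>u\<close> that need
      not be zero; \<open>s\<close> is the room left in the triangle inequality.\<close>
    then obtain s where s: "0 < s"
      "\<forall>b<ennreal s. b + local_measure_dist M U f < ennreal r"
      by (rule ennreal_less_add_obtain)
    show "\<forall>\<^sub>F z in F \<times>\<^sub>F F. ?\<phi> z \<in> A"
      using cauchy_meas[OF U s(1)] dom2
    proof eventually_elim
      case (elim z)
      then have m: "(\<lambda>x. fst z x - snd z x) \<in> borel_measurable M"
        by (intro borel_measurable_diff) (simp_all add: V_def)
      show ?case
        unfolding in_A[OF m]
        by (rule le_less_trans[OF local_measure_dist_triangle[OF U(1) m f] s(2)[rule_format]])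
          (use elim in \<open>simp add: split_beta\<close>)
    qed
  qed
  have cauchy_semi: "\<forall>\<^sub>F z in F \<times>\<^sub>F F. ?\<phi> z \<in> W"
    if "openin (form_seminorm_topology M E) W" "L0_zero M \<in> W" for W
    using that unfolding form_seminorm_topology_def
  proof (rule eventually_topology_generated_by)
    fix A assume "A \<in> {{v \<in> ?D. sqrt_ennreal (E (L0_diff M v u)) < ennreal r} | u r. u \<in> ?D \<and> 0 < r}"
    then obtain u r where A: "A = {v \<in> ?D. sqrt_ennreal (E (L0_diff M v u)) < ennreal r}"
      and u: "u \<in> ?D" and r: "0 < r" by blast
    obtain f where f: "f \<in> V" and uf: "u = ?c f" using D_V[OF u] by blast
    have in_A: "?c g \<in> A \<longleftrightarrow> sqrt (q (\<lambda>x. g x - f x)) < r" if g: "g \<in> V" for g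
    proof -
      have "L0_diff M (?c g) u = ?c (\<lambda>x. g x - f x)"
        using f g by (simp add: uf V_def L0_diff_class)
      then show ?thesis
        using V_D[OF g] q_nonneg[OF V_diff[OF g f]] by (simp add: A sqrt_E[OF V_diff[OF g f]] ennreal_less_iff)
    qed
    assume "L0_zero M \<in> A"
    then have f_r: "sqrt (q f) < r"
      using in_A[OF V_zero] q_minus[OF f] by (simp add: L0_zero_def)
    \<comment> \<open>Again the room left in a ball not centred at zero, squared because the
      seminorm is the root of the form.\<close>
    then have "0 < (r - sqrt (q f))\<^sup>2" by simp
    from cauchy_form[OF this] show "\<forall>\<^sub>F z in F \<times>\<^sub>F F. ?\<phi> z \<in> A"
      using dom2
    proof eventually_elim
      case (elim z)
      then have d: "(\<lambda>x. fst z x - snd z x) \<in> V" by (intro V_diff) auto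
      have "sqrt_ennreal (E (?\<phi> z)) < ennreal (r - sqrt (q f))"
        using elim f_r by (subst sqrt_ennreal_less_iff) (auto simp: split_beta)
      then have "sqrt (q (\<lambda>x. fst z x - snd z x)) < r - sqrt (q f)"
        using q_nonneg[OF d] by (simp add: sqrt_E[OF d] ennreal_less_iff)
      moreover have "sqrt (q (\<lambda>x. fst z x - snd z x - f x)) \<le> sqrt (q (\<lambda>x. fst z x - snd z x)) + sqrt (q f)"
        using q_triangle[OF d V_scale[OF f, of "- 1"]] q_minus[OF f] by simp
      ultimately show ?case unfolding in_A[OF d] by simp
    qed
  qed
  have "L0_complete M ?T ?D" using closed by (simp add: closed_form_def)
  moreover have "filtermap ?c F \<le> principal ?D"
    using dom unfolding le_principal eventually_filtermap
    by (rule eventually_mono) (auto simp: form_domain_def L0_class_mem)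
  moreover have "filtermap ?c F \<noteq> bot" using \<open>F \<noteq> bot\<close> by (simp add: filtermap_bot_iff)
  moreover have "L0_cauchy_filter M ?T (filtermap ?c F)"
    unfolding L0_cauchy_filter_def
  proof (intro allI impI, elim conjE)
    fix N assume N: "openin ?T N" "L0_zero M \<in> N"
    have "\<forall>\<^sub>F z in F \<times>\<^sub>F F. ?\<phi> z \<in> N"
      using N unfolding form_topology_def
    proof (rule eventually_topology_generated_by)
      fix A assume "A \<in> {W. openin (subtopology (L0_topology M) ?D) W} \<union> {W. openin (form_seminorm_topology M E) W}"
        and "L0_zero M \<in> A"
      then consider W where "openin (L0_topology M) W" "L0_zero M \<in> W" "A = W \<inter> ?D"
        | "openin (form_seminorm_topology M E) A"
        by (auto simp: openin_subtopology)
      then show "\<forall>\<^sub>F z in F \<times>\<^sub>F F. ?\<phi> z \<in> A"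
      proof cases
        case 1
        show ?thesis
          using cauchy_L0[OF 1(1,2)] dom2 by eventually_elim (auto simp: 1(3) intro!: V_D V_diff)
      qed (use cauchy_semi \<open>L0_zero M \<in> A\<close> in blast)
    qed
    then have "\<forall>\<^sub>F z in F \<times>\<^sub>F F. L0_diff M (?c (fst z)) (?c (snd z)) \<in> N"
      using dom2 by eventually_elim (simp add: V_def L0_diff_class)
    then obtain P where P: "eventually P F" "\<And>u v. P u \<Longrightarrow> P v \<Longrightarrow> L0_diff M (?c u) (?c v) \<in> N"
      by (auto simp: eventually_prod_same)
    show "\<forall>\<^sub>F (u, v) in filtermap ?c F \<times>\<^sub>F filtermap ?c F. L0_diff M u v \<in> N"
      unfolding eventually_prod_same
    proof (intro exI[of _ "\<lambda>u. \<exists>f. P f \<and> u = ?c f"] conjI)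
      show "\<forall>\<^sub>F u in filtermap ?c F. \<exists>f. P f \<and> u = ?c f"
        unfolding eventually_filtermap using P(1) by (auto elim: eventually_mono)
    qed (use P(2) in auto)
  qed
  ultimately obtain u where u: "u \<in> ?D" and lim: "filtermap ?c F \<le> nhdsin ?T u"
    unfolding L0_complete_def by blast
  obtain f where f: "f \<in> V" and uf: "u = ?c f" using D_V[OF u] by blast
  have fm: "f \<in> borel_measurable M" using f by (simp add: V_def)
  have ev_open: "\<forall>\<^sub>F v in F. ?c v \<in> N" if "openin ?T N" "u \<in> N" for N
  proof -
    have "\<forall>\<^sub>F v in nhdsin ?T u. v \<in> N"
      unfolding eventually_nhdsin using that by blast
    then show ?thesis using lim by (auto simp: le_filter_def eventually_filtermap)
  qed
  have dom': "\<forall>\<^sub>F v in F. v \<in> V" using dom by (simp add: V_def)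
  show thesis
  proof
    show "f \<in> borel_measurable M" "E (?c f) < \<infinity>" using f by (auto simp: V_def)
    fix r :: real assume r: "0 < r"
    let ?N = "{v \<in> ?D. sqrt_ennreal (E (L0_diff M v u)) < ennreal (sqrt r)}"
    have "openin (form_seminorm_topology M E) ?N"
      unfolding form_seminorm_topology_def
      by (rule topology_generated_by_Basis) (use u r in \<open>auto intro!: exI[of _ u] exI[of _ "sqrt r"]\<close>)
    then have "openin ?T ?N"
      unfolding form_topology_def by (intro topology_generated_by_Basis) auto
    moreover have "u \<in> ?N"
      using u r q_zero by (simp add: uf L0_diff_class[OF fm fm] sqrt_E[OF V_zero])
    ultimately have "\<forall>\<^sub>F v in F. ?c v \<in> ?N" by (rule ev_open)
    then show "\<forall>\<^sub>F u in F. E (?c (\<lambda>x. u x - f x)) < ennreal r"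
      using dom'
    proof eventually_elim
      case (elim v)
      then show ?case
        using r fm sqrt_ennreal_less_iff[of "sqrt r"] by (simp add: V_def uf L0_diff_class)
    qed
    fix U assume U: "U \<in> sets M" "emeasure M U < \<infinity>"
    let ?W = "{v \<in> L0 M. L0_gauge M U (L0_diff M v u) < ennreal r}"
    have "openin (L0_topology M) ?W"
      unfolding L0_topology_def
      by (rule topology_generated_by_Basis) (use u r U in \<open>auto simp: form_domain_def intro!: exI[of _ U] exI[of _ u] exI[of _ r]\<close>)
    then have "openin (subtopology (L0_topology M) ?D) (?W \<inter> ?D)"
      by (auto simp: openin_subtopology)
    then have "openin ?T (?W \<inter> ?D)"
      unfolding form_topology_def by (intro topology_generated_by_Basis) auto
    moreover have "u \<in> ?W \<inter> ?D"
      using u r by (simp add: uf L0_diff_class[OF fm fm] L0_gauge_class L0_class_mem fm)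
    ultimately have "\<forall>\<^sub>F v in F. ?c v \<in> ?W \<inter> ?D" by (rule ev_open)
    then show "\<forall>\<^sub>F u in F. local_measure_dist M U (\<lambda>x. u x - f x) < ennreal r"
      using dom'
    proof eventually_elim
      case (elim v)
      then have v: "v \<in> borel_measurable M" by (simp add: V_def)
      show ?case
        using elim L0_gauge_class[OF borel_measurable_diff[OF v fm], of U]
        by (simp add: uf L0_diff_class[OF v fm] local_measure_dist_def)
    qed
  qed
qed


section \<open>Closed forms as suprema of infimal convolutions\<close>

text \<open>
  Distinguishing whether \<open>\<bar>f\<bar>\<close> exceeds \<open>c h\<^sup>2\<close>, one finds
  \<open>min \<bar>f\<bar> 1 \<le> min (c h\<^sup>2) 1 + f\<^sup>2 / (c h\<^sup>2)\<close>. The first summand is small on \<open>U\<close> for small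
  \<open>c\<close>, and the second one is a weighted square integral.
\<close>

lemma local_measure_dist_le_wnorm:
  assumes U[measurable]: "U \<in> sets M" and fin: "emeasure M U < \<infinity>"
    and h[measurable]: "h \<in> borel_measurable M" and h1: "\<And>x. 1 \<le> h x"
    and "0 < r" "0 \<le> K"
  obtains w where "w \<in> borel_measurable M" "\<forall>x. 0 \<le> w x" "wnorm M w h < \<infinity>"
    "\<forall>f\<in>borel_measurable M. wnorm M w f \<le> ennreal K \<longrightarrow> local_measure_dist M U f < ennreal r"
proof -
  have h0: "0 < h x" for x using h1[of x] by linarith
  have "(\<lambda>n. \<integral>\<^sup>+x. ennreal (min ((h x)\<^sup>2 / real (Suc n)) 1) * indicator U x \<partial>M) \<longlonglongrightarrow> (\<integral>\<^sup>+x. 0 \<partial>M)"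
  proof (rule nn_integral_dominated_convergence[where w = "indicator U"])
    show "(\<integral>\<^sup>+x. indicator U x \<partial>M) < \<infinity>" using fin by simp
    show "AE x in M. (\<lambda>n. ennreal (min ((h x)\<^sup>2 / real (Suc n)) 1) * indicator U x) \<longlonglongrightarrow> 0"
    proof (rule AE_I2)
      fix x
      have "(\<lambda>n. (h x)\<^sup>2 * (1 / real (Suc n))) \<longlonglongrightarrow> (h x)\<^sup>2 * 0"
        by (intro tendsto_mult tendsto_const LIMSEQ_Suc[OF lim_1_over_n])
      then have "(\<lambda>n. ennreal (min ((h x)\<^sup>2 / real (Suc n)) 1) * indicator U x)
          \<longlonglongrightarrow> ennreal (min 0 1) * indicator U x"
        by (intro tendsto_intros tendsto_mult_ennreal tendsto_ennrealI tendsto_min)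
          (auto simp: indicator_def split: if_splits)
      then show "(\<lambda>n. ennreal (min ((h x)\<^sup>2 / real (Suc n)) 1) * indicator U x) \<longlonglongrightarrow> 0" by simp
    qed
    show "AE x in M. ennreal (min ((h x)\<^sup>2 / real (Suc n)) 1) * indicator U x \<le> indicator U x" for n
      by (intro AE_I2) (auto simp: indicator_def)
  qed auto
  then have "\<forall>\<^sub>F n in sequentially.
      (\<integral>\<^sup>+x. ennreal (min ((h x)\<^sup>2 / real (Suc n)) 1) * indicator U x \<partial>M) < ennreal (r / 2)"
    using \<open>0 < r\<close> by (intro order_tendstoD(2)) auto
  then obtain n where n:
    "(\<integral>\<^sup>+x. ennreal (min ((h x)\<^sup>2 / real (Suc n)) 1) * indicator U x \<partial>M) < ennreal (r / 2)"
    by (auto simp: eventually_sequentially)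
  define c where "c = 1 / real (Suc n)"
  have c: "0 < c" by (simp add: c_def)
  \<comment> \<open>The factor \<open>t\<close> makes the quadratic part at most
    \<open>K / t < r / 2\<close>; the summand 1 keeps it positive when \<open>K = 0\<close>.\<close>
  define t where "t = 2 * (K + 1) / r"
  have t: "0 < t" "K / t < r / 2"
    using \<open>0 < r\<close> \<open>0 \<le> K\<close> by (auto simp: t_def field_simps)
  \<comment> \<open>With this weight \<open>w * h\<^sup>2\<close> is the constant
    \<open>t / c\<close> on \<open>U\<close> and 0 off \<open>U\<close>, hence integrable.\<close>
  define w where "w x = t * (indicator U x / (c * (h x)\<^sup>2))" for x
  have w_meas[measurable]: "w \<in> borel_measurable M" unfolding w_def[abs_def] by measurable
  have w_nonneg: "0 \<le> w x" for x using c t by (simp add: w_def)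
  show thesis
  proof
    show "w \<in> borel_measurable M" "\<forall>x. 0 \<le> w x" by (auto simp: w_nonneg)
    have "w x * (h x)\<^sup>2 = t / c * indicator U x" for x
      using h0[of x] by (simp add: w_def)
    then have "wnorm M w h = (\<integral>\<^sup>+x. ennreal (t / c) * indicator U x \<partial>M)"
      unfolding wnorm_def by (intro nn_integral_cong) (simp add: indicator_def)
    also have "\<dots> = ennreal (t / c) * emeasure M U" by (simp add: nn_integral_cmult)
    finally show "wnorm M w h < \<infinity>" using fin by (simp add: ennreal_mult_less_top)
    show "\<forall>f\<in>borel_measurable M. wnorm M w f \<le> ennreal K \<longrightarrow> local_measure_dist M U f < ennreal r"
    proof (intro ballI impI)
      fix f assume f[measurable]: "f \<in> borel_measurable M" and le: "wnorm M w f \<le> ennreal K"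
      have pw: "min \<bar>f x\<bar> 1 \<le> min (c * (h x)\<^sup>2) 1 + (f x)\<^sup>2 / (c * (h x)\<^sup>2)" for x
      proof (cases "\<bar>f x\<bar> \<le> c * (h x)\<^sup>2")
        case True
        have "0 \<le> (f x)\<^sup>2 / (c * (h x)\<^sup>2)" using c by simp
        with True show ?thesis by linarith
      next
        case False
        have pos: "0 < c * (h x)\<^sup>2" using c h0[of x] by simp
        have "\<bar>f x\<bar> * (c * (h x)\<^sup>2) \<le> \<bar>f x\<bar> * \<bar>f x\<bar>"
          using False by (intro mult_left_mono) auto
        then have "\<bar>f x\<bar> \<le> (f x)\<^sup>2 / (c * (h x)\<^sup>2)"
          using pos by (simp add: pos_le_divide_eq power2_eq_square)
        with pos show ?thesis by linarith
      qed
      have "local_measure_dist M U f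
        \<le> (\<integral>\<^sup>+x. ennreal (min ((h x)\<^sup>2 / real (Suc n)) 1) * indicator U x + ennreal (1 / t) * ennreal (w x * (f x)\<^sup>2) \<partial>M)"
        unfolding local_measure_dist_def
      proof (rule nn_integral_mono)
        fix x
        show "ennreal (min \<bar>f x\<bar> 1) * indicator U x
          \<le> ennreal (min ((h x)\<^sup>2 / real (Suc n)) 1) * indicator U x + ennreal (1 / t) * ennreal (w x * (f x)\<^sup>2)"
        proof (cases "x \<in> U")
          case True
          have "ennreal (1 / t) * ennreal (w x * (f x)\<^sup>2) = ennreal ((f x)\<^sup>2 / (c * (h x)\<^sup>2))"
            using True t c by (simp add: w_def flip: ennreal_mult)
          moreover have "ennreal (min \<bar>f x\<bar> 1)
            \<le> ennreal (min (c * (h x)\<^sup>2) 1) + ennreal ((f x)\<^sup>2 / (c * (h x)\<^sup>2))"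
            using pw[of x] c by (simp flip: ennreal_plus)
          ultimately show ?thesis using True by (simp add: c_def)
        qed simp
      qed
      also have "\<dots> = (\<integral>\<^sup>+x. ennreal (min ((h x)\<^sup>2 / real (Suc n)) 1) * indicator U x \<partial>M) + ennreal (1 / t) * wnorm M w f"
        unfolding wnorm_def by (subst nn_integral_add) (auto simp: nn_integral_cmult)
      also have "\<dots> < ennreal (r / 2) + ennreal (r / 2)"
      proof (rule add_strict_mono[OF n])
        have "ennreal (1 / t) * wnorm M w f \<le> ennreal (1 / t) * ennreal K"
          using le by (rule mult_left_mono) simp
        also have "\<dots> = ennreal (K / t)" using t \<open>0 \<le> K\<close> by (simp flip: ennreal_mult)
        also have "\<dots> < ennreal (r / 2)" using t \<open>0 < r\<close> \<open>0 \<le> K\<close> by (intro ennreal_lessI) auto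
        finally show "ennreal (1 / t) * wnorm M w f < ennreal (r / 2)" .
      qed
      also have "\<dots> = ennreal r" using \<open>0 < r\<close> by (simp flip: ennreal_plus)
      finally show "local_measure_dist M U f < ennreal r" .
    qed
  qed
qed

text \<open>
  The midpoint \<open>(u + v) / 2\<close> competes in the infimum as well.
\<close>

lemma inf_conv_near_minimisers:
  assumes p: "quadratic_functional M p" and n: "quadratic_functional M n"
    and [measurable]: "f \<in> borel_measurable M" "u \<in> borel_measurable M" "v \<in> borel_measurable M"
    and u: "p u + n (\<lambda>x. u x - f x) \<le> inf_conv M p n f + ennreal \<eta>"
    and v: "p v + n (\<lambda>x. v x - f x) \<le> inf_conv M p n f + ennreal \<eta>"
    and fin: "inf_conv M p n f < \<infinity>" and "0 \<le> \<eta>"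
  shows "p (\<lambda>x. u x - v x) \<le> ennreal (4 * \<eta>)"
proof -
  let ?Q = "inf_conv M p n f"
  define s where "s x = (u x + v x) / 2" for x
  have s[measurable]: "s \<in> borel_measurable M" unfolding s_def[abs_def] by measurable
  have "(\<lambda>x. u x + v x) = (\<lambda>x. 2 * s x)"
    by (auto simp: s_def)
  moreover have "p (\<lambda>x. u x + v x) + p (\<lambda>x. u x - v x) = 2 * p u + 2 * p v"
    using p unfolding quadratic_functional_def by simp
  ultimately have "p (\<lambda>x. 2 * s x) + p (\<lambda>x. u x - v x) = 2 * p u + 2 * p v"
    by simp
  then have ps: "4 * p s + p (\<lambda>x. u x - v x) = 2 * p u + 2 * p v"
    using p s unfolding quadratic_functional_def by simp
  have "n (\<lambda>x. a x + b x) + n (\<lambda>x. a x - b x) = 2 * n a + 2 * n b"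
    if "a \<in> borel_measurable M" "b \<in> borel_measurable M" for a b :: "'a \<Rightarrow> real"
    using n that unfolding quadratic_functional_def by blast
  from this[of "\<lambda>x. u x - f x" "\<lambda>x. v x - f x"]
  have "n (\<lambda>x. (u x - f x) + (v x - f x)) + n (\<lambda>x. (u x - f x) - (v x - f x))
    = 2 * n (\<lambda>x. u x - f x) + 2 * n (\<lambda>x. v x - f x)"
    by (auto intro!: borel_measurable_diff)
  moreover have "(\<lambda>x. (u x - f x) + (v x - f x)) = (\<lambda>x. 2 * (s x - f x))"
    by (auto simp: s_def)
  moreover have "n (\<lambda>x. c * a x) = ennreal (c\<^sup>2) * n a" if "a \<in> borel_measurable M" for c and a :: "'a \<Rightarrow> real"
    using n that unfolding quadratic_functional_def by blast
  from this[of "\<lambda>x. s x - f x" 2] have "n (\<lambda>x. 2 * (s x - f x)) = 4 * n (\<lambda>x. s x - f x)"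
    by (auto intro!: borel_measurable_diff)
  ultimately have ns: "4 * n (\<lambda>x. s x - f x) \<le> 2 * n (\<lambda>x. u x - f x) + 2 * n (\<lambda>x. v x - f x)"
    by (metis le_iff_add)
  have "4 * ?Q + p (\<lambda>x. u x - v x) \<le> 4 * (p s + n (\<lambda>x. s x - f x)) + p (\<lambda>x. u x - v x)"
    by (intro add_mono mult_left_mono inf_conv_lower s) auto
  also have "\<dots> = (4 * p s + p (\<lambda>x. u x - v x)) + 4 * n (\<lambda>x. s x - f x)"
    by (simp add: distrib_left add_ac)
  also have "\<dots> \<le> (2 * p u + 2 * p v) + (2 * n (\<lambda>x. u x - f x) + 2 * n (\<lambda>x. v x - f x))"
    unfolding ps by (rule add_left_mono[OF ns])
  also have "\<dots> = 2 * (p u + n (\<lambda>x. u x - f x)) + 2 * (p v + n (\<lambda>x. v x - f x))"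
    by (simp add: distrib_left add_ac)
  also have "\<dots> \<le> 2 * (?Q + ennreal \<eta>) + 2 * (?Q + ennreal \<eta>)"
    by (rule add_mono; rule mult_left_mono) (use u v in auto)
  also have "\<dots> = 4 * ?Q + 4 * ennreal \<eta>"
    by (simp flip: distrib_right mult_2 mult.assoc add: distrib_left)
  also have "4 * ennreal \<eta> = ennreal (4 * \<eta>)"
    using \<open>0 \<le> \<eta>\<close> by (simp add: ennreal_mult)
  \<comment> \<open>Finiteness of the infimum allows \<open>4 * ?Q\<close> to be cancelled.\<close>
  finally show ?thesis
    using fin by (subst (asm) ennreal_add_left_cancel_le) (auto simp: ennreal_mult_less_top ennreal_mult_eq_top_iff)
qed

text \<open>
  A closed form is the supremum of its infimal convolutions with weighted square integrals: the near
  minimisers form a Cauchy filter for the form topology whose limit can only be \<open>f\<close>. Choosing the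
  weights small where \<open>f\<close> is large makes all the integrals finite.
\<close>

lemma closed_form_le_if_inf_conv_le:
  assumes closed: "closed_form M E" and semi: "semifinite M"
    and h[measurable]: "h \<in> borel_measurable M" and h1: "\<And>x. 1 \<le> h x"
    and f[measurable]: "f \<in> borel_measurable M"
    and bound: "\<And>w. w \<in> borel_measurable M \<Longrightarrow> (\<And>x. 0 \<le> w x) \<Longrightarrow> wnorm M w h < \<infinity> \<Longrightarrow>
      inf_conv M (\<lambda>u. E (L0_class M u)) (wnorm M w) f \<le> ennreal K"
  shows "E (L0_class M f) \<le> ennreal K"
proof -
  let ?p = "\<lambda>u. E (L0_class M u)"
  define W where "W = {w \<in> borel_measurable M. (\<forall>x. 0 \<le> w x) \<and> wnorm M w h < \<infinity>}"
  define Q where "Q w = inf_conv M ?p (wnorm M w) f" for w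
  define \<Phi> where "\<Phi> w u = ?p u + wnorm M w (\<lambda>x. u x - f x)" for w u
  have p: "quadratic_functional M ?p"
    using closed by (intro quadratic_functional_form) (simp add: closed_form_def)
  have wn: "quadratic_functional M (wnorm M w)" if "w \<in> W" for w
    using that by (intro quadratic_functional_wnorm) (auto simp: W_def)
  have W0: "(\<lambda>x. 0) \<in> W" by (simp add: W_def wnorm_def)
  define S where "S = (SUP w\<in>W. Q w)"
  have S_K: "S \<le> ennreal K" unfolding S_def Q_def by (rule SUP_least) (auto simp: W_def bound)
  then obtain I where I: "S = ennreal I" "0 \<le> I" by (cases S) (auto simp: top_unique)
  have Q_I: "Q w \<le> ennreal I" if "w \<in> W" for w
    using that unfolding I(1)[symmetric] S_def by (rule SUP_upper)
  have wnorm_add: "wnorm M (\<lambda>x. w x + w' x) g = wnorm M w g + wnorm M w' g"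
    if "w \<in> W" "w' \<in> W" "g \<in> borel_measurable M" for w w' g
  proof -
    note [measurable] = that(3)
    have [measurable]: "w \<in> borel_measurable M" "w' \<in> borel_measurable M" using that by (auto simp: W_def)
    have "wnorm M (\<lambda>x. w x + w' x) g = (\<integral>\<^sup>+x. ennreal (w x * (g x)\<^sup>2) + ennreal (w' x * (g x)\<^sup>2) \<partial>M)"
      unfolding wnorm_def using that(1,2)
      by (intro nn_integral_cong) (auto simp: W_def distrib_right)
    also have "\<dots> = wnorm M w g + wnorm M w' g"
      unfolding wnorm_def by (rule nn_integral_add) auto
    finally show ?thesis .
  qed
  have W_add: "(\<lambda>x. w x + w' x) \<in> W" if "w \<in> W" "w' \<in> W" for w w'
    using wnorm_add[OF that h] that by (auto simp: W_def)
  \<comment> \<open>Near minimisers are measured against the common level \<open>I\<close>, not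
    against \<open>Q w\<close>. As \<open>\<Phi>\<close> increases with the weight, the sets for
    \<open>w + w'\<close> then lie in those for \<open>w\<close> and for \<open>w'\<close>, and all
    these sets form a filter base.\<close>
  define G where "G w \<eta> = {u \<in> borel_measurable M. \<Phi> w u \<le> ennreal (I + \<eta>)}" for w \<eta>
  define F where "F = (INF (w, \<eta>)\<in>W \<times> {0<..}. principal (G w \<eta>))"
  have G_dir: "G (\<lambda>x. w x + w' x) (min \<eta> \<eta>') \<subseteq> G w \<eta> \<inter> G w' \<eta>'" if "w \<in> W" "w' \<in> W" for w w' \<eta> \<eta>'
  proof
    fix u assume "u \<in> G (\<lambda>x. w x + w' x) (min \<eta> \<eta>')"
    then have u: "u \<in> borel_measurable M" and le: "\<Phi> (\<lambda>x. w x + w' x) u \<le> ennreal (I + min \<eta> \<eta>')"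
      by (auto simp: G_def)
    have "\<Phi> (\<lambda>x. w x + w' x) u = \<Phi> w u + wnorm M w' (\<lambda>x. u x - f x)"
      "\<Phi> (\<lambda>x. w x + w' x) u = \<Phi> w' u + wnorm M w (\<lambda>x. u x - f x)"
      using u that by (simp_all add: \<Phi>_def wnorm_add add_ac)
    then have "\<Phi> w u \<le> \<Phi> (\<lambda>x. w x + w' x) u" "\<Phi> w' u \<le> \<Phi> (\<lambda>x. w x + w' x) u"
      by (metis le_iff_add)+
    with le have "\<Phi> w u \<le> ennreal (I + min \<eta> \<eta>')" "\<Phi> w' u \<le> ennreal (I + min \<eta> \<eta>')"
      by (meson order_trans)+
    moreover have "ennreal (I + min \<eta> \<eta>') \<le> ennreal (I + \<eta>)" "ennreal (I + min \<eta> \<eta>') \<le> ennreal (I + \<eta>')"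
      by (auto intro: ennreal_leI)
    ultimately show "u \<in> G w \<eta> \<inter> G w' \<eta>'" using u by (auto simp: G_def intro: order_trans)
  qed
  have ev_F: "eventually P F \<longleftrightarrow> (\<exists>w\<in>W. \<exists>\<eta>>0. \<forall>u\<in>G w \<eta>. P u)" for P
  proof -
    have "eventually P F \<longleftrightarrow> (\<exists>b\<in>W \<times> {0<..}. eventually P (case b of (w, \<eta>) \<Rightarrow> principal (G w \<eta>)))"
      unfolding F_def
    proof (rule eventually_INF_base)
      show "W \<times> {0 :: real<..} \<noteq> {}" using W0 by (auto intro: exI[of _ "1 :: real"])
      fix a b assume "a \<in> W \<times> {0 :: real<..}" "b \<in> W \<times> {0 :: real<..}"
      then show "\<exists>x\<in>W \<times> {0<..}. (case x of (w, \<eta>) \<Rightarrow> principal (G w \<eta>))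
          \<le> inf (case a of (w, \<eta>) \<Rightarrow> principal (G w \<eta>)) (case b of (w, \<eta>) \<Rightarrow> principal (G w \<eta>))"
        using G_dir[of "fst a" "fst b" "snd a" "snd b"] W_add[of "fst a" "fst b"]
        by (intro bexI[of _ "(\<lambda>x. fst a x + fst b x, min (snd a) (snd b))"]) (auto simp: split_beta)
    qed
    also have "\<dots> \<longleftrightarrow> (\<exists>w\<in>W. \<exists>\<eta>>0. \<forall>u\<in>G w \<eta>. P u)"
      by (auto simp: eventually_principal)
    finally show ?thesis .
  qed
  have G_nonempty: "G w \<eta> \<noteq> {}" if "w \<in> W" "0 < \<eta>" for w \<eta>
  proof -
    have "Q w < ennreal (I + \<eta>)"
      using Q_I[OF that(1)] I(2) that(2) by (auto intro: le_less_trans ennreal_lessI)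
    then show ?thesis
      unfolding Q_def by (rule inf_conv_approx) (force simp: G_def \<Phi>_def)
  qed
  have F: "F \<noteq> bot"
    using G_nonempty by (auto simp: trivial_limit_def ev_F)
  \<comment> \<open>At the zero weight \<open>\<Phi>\<close> reduces to the form itself.\<close>
  have ev_E: "\<forall>\<^sub>F u in F. u \<in> borel_measurable M \<and> ?p u \<le> ennreal (I + \<eta>)" if "0 < \<eta>" for \<eta>
    unfolding ev_F using W0 that by (intro bexI[of _ "\<lambda>x. 0"]) (auto simp: G_def \<Phi>_def wnorm_def)
  have ev_dist: "\<forall>\<^sub>F u in F. local_measure_dist M U (\<lambda>x. u x - f x) < ennreal r"
    if U: "U \<in> sets M" "emeasure M U < \<infinity>" and r: "0 < r" for U r
  proof -
    have "0 \<le> I + 1" using I(2) by simp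
    from local_measure_dist_le_wnorm[OF U h h1 r this]
    obtain w where w: "w \<in> borel_measurable M" "\<forall>x. 0 \<le> w x" "wnorm M w h < \<infinity>"
      and wd: "\<forall>f\<in>borel_measurable M. wnorm M w f \<le> ennreal (I + 1) \<longrightarrow> local_measure_dist M U f < ennreal r" .
    have "local_measure_dist M U (\<lambda>x. u x - f x) < ennreal r" if "u \<in> G w 1" for u
    proof -
      have u: "u \<in> borel_measurable M" "\<Phi> w u \<le> ennreal (I + 1)" using that by (auto simp: G_def)
      have "wnorm M w (\<lambda>x. u x - f x) \<le> \<Phi> w u" by (simp add: \<Phi>_def)
      with u have "wnorm M w (\<lambda>x. u x - f x) \<le> ennreal (I + 1)" by (meson order_trans)
      then show ?thesis using wd u f by simp
    qed
    moreover have "w \<in> W" using w by (simp add: W_def)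
    ultimately show ?thesis unfolding ev_F by (intro bexI[of _ w] exI[of _ 1]) auto
  qed
  \<comment> \<open>Finiteness of the form at \<open>f\<close> is not yet known. Completeness
    provides a limit \<open>g\<close> in the domain, and \<open>F\<close> converges locally in
    measure to both \<open>f\<close> and \<open>g\<close>, which identifies them.\<close>
  obtain g where g[measurable]: "g \<in> borel_measurable M" and g_fin: "?p g < \<infinity>"
    and g_dist: "\<And>U r. U \<in> sets M \<Longrightarrow> emeasure M U < \<infinity> \<Longrightarrow> 0 < r \<Longrightarrow>
      \<forall>\<^sub>F u in F. local_measure_dist M U (\<lambda>x. u x - g x) < ennreal r"
    and g_form: "\<And>r. 0 < r \<Longrightarrow> \<forall>\<^sub>F u in F. ?p (\<lambda>x. u x - g x) < ennreal r"
  proof (rule closed_form_limit[OF closed F])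
    show "\<forall>\<^sub>F u in F. u \<in> borel_measurable M \<and> ?p u < \<infinity>"
      using ev_E[OF zero_less_one] by (auto elim!: eventually_mono intro: le_less_trans)
    fix r :: real assume r: "0 < r"
    \<comment> \<open>One \<open>r / 16\<close> compares \<open>Q w\<close> with the supremum and
      another is the slack in \<open>G\<close>. The members of \<open>G w (r / 16)\<close> thus miss
      the infimum by at most \<open>r / 8\<close>, and their differences have energy at most
      \<open>r / 2\<close>.\<close>
    have "\<exists>w\<in>W. S < Q w + ennreal (r / 16)"
      by (rule SUP_approx_ennreal) (use r W0 I in \<open>auto simp: S_def\<close>)
    then obtain w where w: "w \<in> W" "S \<le> Q w + ennreal (r / 16)" by (auto intro: less_imp_le)
    have near: "?p u + wnorm M w (\<lambda>x. u x - f x) \<le> inf_conv M ?p (wnorm M w) f + ennreal (r / 8)"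
      if "u \<in> G w (r / 16)" for u
    proof -
      have "\<Phi> w u \<le> ennreal I + ennreal (r / 16)"
        using that r I(2) by (simp add: G_def flip: ennreal_plus)
      also have "\<dots> \<le> (Q w + ennreal (r / 16)) + ennreal (r / 16)"
        using w(2) I(1) by (intro add_right_mono) simp
      also have "\<dots> = Q w + ennreal (r / 8)"
        using r by (simp add: add.assoc flip: ennreal_plus)
      finally show ?thesis by (simp add: \<Phi>_def Q_def)
    qed
    have fin: "inf_conv M ?p (wnorm M w) f < \<infinity>"
      using Q_I[OF w(1)] by (auto simp: Q_def intro: le_less_trans)
    show "\<forall>\<^sub>F (u, v) in F \<times>\<^sub>F F. ?p (\<lambda>x. u x - v x) < ennreal r"
      unfolding eventually_prod_same
    proof (intro exI[of _ "\<lambda>u. u \<in> G w (r / 16)"] conjI allI impI)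
      show "\<forall>\<^sub>F u in F. u \<in> G w (r / 16)"
        unfolding ev_F using w(1) r by (intro bexI[of _ w] exI[of _ "r / 16"]) auto
      fix u v assume u: "u \<in> G w (r / 16)" and v: "v \<in> G w (r / 16)"
      then have m: "u \<in> borel_measurable M" "v \<in> borel_measurable M" by (auto simp: G_def)
      have "?p (\<lambda>x. u x - v x) \<le> ennreal (4 * (r / 8))"
        using r by (intro inf_conv_near_minimisers[OF p wn[OF w(1)] f m near[OF u] near[OF v] fin]) simp
      also have "\<dots> < ennreal r" using r by (intro ennreal_lessI) auto
      finally show "case (u, v) of (u, v) \<Rightarrow> ?p (\<lambda>x. u x - v x) < ennreal r" by simp
    qed
    fix U assume U: "U \<in> sets M" "emeasure M U < \<infinity>"
    have "0 < r / 2" using r by simp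
    have "\<forall>\<^sub>F u in F. u \<in> borel_measurable M \<and> local_measure_dist M U (\<lambda>x. u x - f x) < ennreal (r / 2)"
      using ev_dist[OF U \<open>0 < r / 2\<close>] ev_E[OF zero_less_one] by eventually_elim auto
    then show "\<forall>\<^sub>F (u, v) in F \<times>\<^sub>F F. local_measure_dist M U (\<lambda>x. u x - v x) < ennreal r"
      unfolding eventually_prod_same
    proof (intro exI conjI allI impI, assumption)
      fix u v
      assume u: "u \<in> borel_measurable M \<and> local_measure_dist M U (\<lambda>x. u x - f x) < ennreal (r / 2)"
        and v: "v \<in> borel_measurable M \<and> local_measure_dist M U (\<lambda>x. v x - f x) < ennreal (r / 2)"
      have "local_measure_dist M U (\<lambda>x. (u x - f x) - (v x - f x))
        \<le> local_measure_dist M U (\<lambda>x. u x - f x) + local_measure_dist M U (\<lambda>x. v x - f x)"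
        using u v f U by (intro local_measure_dist_triangle) auto
      also have "\<dots> < ennreal (r / 2) + ennreal (r / 2)" using u v by (intro add_strict_mono) auto
      also have "\<dots> = ennreal r" using r by (simp flip: ennreal_plus)
      finally show "case (u, v) of (u, v) \<Rightarrow> local_measure_dist M U (\<lambda>x. u x - v x) < ennreal r" by simp
    qed
  qed (rule that; (assumption | blast))
  have "AE x in M. f x = g x"
  proof (rule AE_eq_if_local_measure_dist_zero[OF semi f g])
    fix U assume U: "U \<in> sets M" "emeasure M U < \<infinity>"
    have "local_measure_dist M U (\<lambda>x. f x - g x) \<le> ennreal r" if "0 < r" for r
    proof -
      from that have "0 < r / 2" by simp
      have "\<forall>\<^sub>F u in F. u \<in> borel_measurable M \<and> local_measure_dist M U (\<lambda>x. u x - f x) < ennreal (r / 2)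
          \<and> local_measure_dist M U (\<lambda>x. u x - g x) < ennreal (r / 2)"
        using ev_dist[OF U \<open>0 < r / 2\<close>] g_dist[OF U \<open>0 < r / 2\<close>] ev_E[OF zero_less_one] by eventually_elim auto
      then obtain u where [measurable]: "u \<in> borel_measurable M"
        and u: "local_measure_dist M U (\<lambda>x. u x - f x) < ennreal (r / 2)"
          "local_measure_dist M U (\<lambda>x. u x - g x) < ennreal (r / 2)"
        using eventually_happens'[OF F] by blast
      have "local_measure_dist M U (\<lambda>x. (u x - g x) - (u x - f x))
        \<le> local_measure_dist M U (\<lambda>x. u x - g x) + local_measure_dist M U (\<lambda>x. u x - f x)"
        using U by (intro local_measure_dist_triangle) auto
      also have "\<dots> \<le> ennreal (r / 2) + ennreal (r / 2)"
        using u by (intro add_mono) auto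
      also have "\<dots> = ennreal r" using that by (simp flip: ennreal_plus)
      finally show ?thesis by simp
    qed
    then have "local_measure_dist M U (\<lambda>x. f x - g x) \<le> 0"
      using ennreal_le_epsilon[of 0 "local_measure_dist M U (\<lambda>x. f x - g x)"] by simp
    then show "local_measure_dist M U (\<lambda>x. f x - g x) = 0" by simp
  qed
  then have fg: "L0_class M f = L0_class M g" by (rule L0_class_eqI[OF f g])
  define V where "V = {f \<in> borel_measurable M. ?p f < \<infinity>}"
  define q where "q f = enn2real (?p f)" for f
  interpret quadratic_space V q
    unfolding V_def q_def by (rule quadratic_space_quadratic_functional[OF p])
  have gV: "g \<in> V" using g_fin by (simp add: V_def)
  have "sqrt (q g) \<le> sqrt I + \<delta>" if "0 < \<delta>" for \<delta>
  proof -
    \<comment> \<open>The tolerance is squared so that each of the two roots contributes at most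
      \<open>\<delta> / 2\<close>.\<close>
    have "0 < (\<delta> / 2)\<^sup>2" using that by simp
    have "\<forall>\<^sub>F u in F. u \<in> borel_measurable M \<and> ?p u \<le> ennreal (I + (\<delta> / 2)\<^sup>2) \<and> ?p (\<lambda>x. u x - g x) < ennreal ((\<delta> / 2)\<^sup>2)"
      using g_form[OF \<open>0 < (\<delta> / 2)\<^sup>2\<close>] ev_E[OF \<open>0 < (\<delta> / 2)\<^sup>2\<close>] by eventually_elim auto
    then obtain u where u: "u \<in> borel_measurable M" "?p u \<le> ennreal (I + (\<delta> / 2)\<^sup>2)"
      and ug: "?p (\<lambda>x. u x - g x) < ennreal ((\<delta> / 2)\<^sup>2)"
      using eventually_happens'[OF F] by blast
    have uV: "u \<in> V" using u by (auto simp: V_def intro: le_less_trans)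
    have "q u \<le> I + (\<delta> / 2)\<^sup>2" using u(2) I(2) by (auto simp: q_def intro: enn2real_leI)
    also have "\<dots> \<le> (sqrt I + \<delta> / 2)\<^sup>2" using I(2) that by (simp add: power2_sum)
    finally have "sqrt (q u) \<le> sqrt I + \<delta> / 2"
      using I(2) that by (intro real_le_lsqrt) auto
    moreover have "q (\<lambda>x. u x - g x) \<le> (\<delta> / 2)\<^sup>2"
      using ug by (auto simp: q_def intro: enn2real_leI)
    then have "sqrt (q (\<lambda>x. u x - g x)) \<le> \<delta> / 2"
      using that by (intro real_le_lsqrt) auto
    ultimately show ?thesis
      using q_triangle_diff[OF gV uV] q_minus[OF V_diff[OF uV gV]] by simp
  qed
  then have "sqrt (q g) \<le> sqrt I" by (rule field_le_epsilon)
  then have "?p g \<le> ennreal I"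
    using g_fin by (cases "?p g") (auto simp: q_def intro: ennreal_leI)
  with S_K I(1) fg show ?thesis by simp
qed


section \<open>Characterisations of energy forms\<close>

lemma markovian_cutoffs:
  assumes "markovian M E" "0 < \<epsilon>"
  shows "\<exists>C. cutoff \<epsilon> C \<and> (\<forall>u\<in>borel_measurable M. E (L0_class M (\<lambda>x. C (u x))) \<le> E (L0_class M u))"
proof -
  obtain C where C: "cutoff \<epsilon> C" "\<And>u. u \<in> L0 M \<Longrightarrow> E (L0_map M C u) \<le> E u"
    using assms unfolding markovian_def by blast
  then have "C \<in> borel_measurable borel"
    by (intro borel_measurable_normal_contraction_real) (simp add: cutoff_def)
  with C(2)[OF L0_class_mem] have "E (L0_class M (\<lambda>x. C (u x))) \<le> E (L0_class M u)"
    if "u \<in> borel_measurable M" for u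
    using that by (metis L0_map_class)
  with C(1) show ?thesis by blast
qed

text \<open>If all energies on the right are finite, the inequality holds for every regularised
  form, whose values at the \<open>gs k\<close> are at most the original ones. The resulting bound
  on the regularised energies of \<open>g\<close> does not depend on the weight and passes to the
  supremum.\<close>

lemma energy_form_pointwise_domination:
  fixes g :: "'a \<Rightarrow> real" and gs :: "nat \<Rightarrow> 'a \<Rightarrow> real"
  assumes semi: "semifinite M" and energy: "energy_form M E"
    and g: "g \<in> borel_measurable M" and gs: "\<And>k. k < n \<Longrightarrow> gs k \<in> borel_measurable M"
    and val: "\<And>x. x \<in> space M \<Longrightarrow> \<bar>g x\<bar> \<le> (\<Sum>k<n. \<bar>gs k x\<bar>)"
    and diff: "\<And>x y. x \<in> space M \<Longrightarrow> y \<in> space M \<Longrightarrow> \<bar>g x - g y\<bar> \<le> (\<Sum>k<n. \<bar>gs k x - gs k y\<bar>)"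
  shows "sqrt_ennreal (E (L0_class M g)) \<le> (\<Sum>k<n. sqrt_ennreal (E (L0_class M (gs k))))"
proof (cases "\<exists>k<n. E (L0_class M (gs k)) = \<infinity>")
  case True
  then obtain k where "k < n" "sqrt_ennreal (E (L0_class M (gs k))) = top"
    by (auto simp: sqrt_ennreal_def)
  then have "top \<le> (\<Sum>k<n. sqrt_ennreal (E (L0_class M (gs k))))"
    using member_le_sum[of k "{..<n}" "\<lambda>k. sqrt_ennreal (E (L0_class M (gs k)))"] by simp
  then show ?thesis by (rule order_trans[OF top_greatest])
next
  case False
  let ?p = "\<lambda>u. E (L0_class M u)"
  have closed: "closed_form M E" and markov: "markovian M E"
    using energy by (auto simp: energy_form_def)
  have p: "quadratic_functional M ?p"
    using closed by (intro quadratic_functional_form) (simp add: closed_form_def)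
  define R where "R = (\<Sum>k<n. sqrt (enn2real (?p (gs k))))"
  have R: "0 \<le> R" unfolding R_def by (intro sum_nonneg) simp
  \<comment> \<open>This dominates all the \<open>gs k\<close> and, by \<open>val\<close>, also
    \<open>g\<close>; the summand 1 keeps it at least 1.\<close>
  define h where "h x = 1 + (\<Sum>k<n. \<bar>gs k x\<bar>)" for x
  have h: "h \<in> borel_measurable M" "\<And>x. 1 \<le> h x"
    unfolding h_def[abs_def] using gs by (auto intro!: borel_measurable_add borel_measurable_sum sum_nonneg)
  have gh: "\<bar>g x\<bar> \<le> h x" if "x \<in> space M" for x
    using val[OF that] by (simp add: h_def)
  have gsh: "\<bar>gs k x\<bar> \<le> h x" if "k < n" for k x
    using member_le_sum[of k "{..<n}" "\<lambda>k. \<bar>gs k x\<bar>"] that by (simp add: h_def)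
  have "?p g \<le> ennreal (R\<^sup>2)"
  proof (rule closed_form_le_if_inf_conv_le[OF closed semi h g])
    fix w assume w: "w \<in> borel_measurable M" "\<And>x. 0 \<le> w x" "wnorm M w h < \<infinity>"
    note wn = quadratic_functional_wnorm[OF w(1,2)]
    let ?Q = "inf_conv M ?p (wnorm M w)"
    have "sqrt (enn2real (?Q g)) \<le> (\<Sum>k<n. sqrt (enn2real (?Q (gs k))))"
      by (rule inf_conv_contraction[OF p markovian_cutoffs[OF markov] w(1,2) h w(3) g gh gs gsh val diff])
    also have "\<dots> \<le> R"
      unfolding R_def
    proof (intro sum_mono, simp, rule enn2real_mono)
      fix k assume k: "k < n"
      then show "?Q (gs k) \<le> ?p (gs k)" using gs by (intro inf_conv_le_left[OF wn]) auto
      show "?p (gs k) < top" using False k by (auto simp: less_top)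
    qed
    finally have "enn2real (?Q g) \<le> R\<^sup>2"
      by (metis enn2real_nonneg real_sqrt_ge_zero real_sqrt_pow2 power_mono)
    moreover have "?Q g < \<infinity>"
    proof -
      have "\<bar>g x\<bar> \<le> \<bar>h x\<bar>" if "x \<in> space M" for x using gh[OF that] by linarith
      then have "?Q g \<le> wnorm M w h"
        using inf_conv_le_right[OF p wn g] wnorm_mono[OF w(2), of M g h] by (meson order_trans)
      then show ?thesis using w(3) by (rule le_less_trans)
    qed
    ultimately show "?Q g \<le> ennreal (R\<^sup>2)"
      by (cases "?Q g") (auto intro: ennreal_leI)
  qed
  then have "sqrt_ennreal (?p g) \<le> sqrt_ennreal (ennreal (R\<^sup>2))"
    by (simp add: sqrt_ennreal_mono_iff)
  also have "\<dots> = ennreal R" using R by (simp add: sqrt_ennreal_def)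
  also have "\<dots> = (\<Sum>k<n. sqrt_ennreal (?p (gs k)))"
    unfolding R_def using False by (subst sum_ennreal[symmetric]) (auto simp: sqrt_ennreal_def)
  finally show ?thesis .
qed

text \<open>The projection onto the unit interval is a normal contraction and a cutoff for every
  positive parameter.\<close>

lemma markovian_if_normal_contractions:
  assumes "\<And>C u. normal_contraction_real C \<Longrightarrow> u \<in> L0 M \<Longrightarrow> E (L0_map M C u) \<le> E u"
  shows "markovian M E"
  unfolding markovian_def
proof (intro allI impI)
  fix \<epsilon> :: real assume "0 < \<epsilon>"
  let ?C = "\<lambda>x :: real. min (max x 0) 1"
  have nc: "normal_contraction_real ?C"
    by (auto simp: normal_contraction_real_def min_def max_def abs_if)
  then have "cutoff \<epsilon> ?C"
    using \<open>0 < \<epsilon>\<close> by (auto simp: cutoff_def mono_def)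
  with nc assms show "\<exists>C. cutoff \<epsilon> C \<and> (\<forall>u\<in>L0 M. E (L0_map M C u) \<le> E u)" by blast
qed

lemma L0_map_n_cases:
  assumes C: "normal_contraction n C" and f: "\<And>k. k < n \<Longrightarrow> f k \<in> L0 M"
  obtains gs where "\<And>k. k < n \<Longrightarrow> gs k \<in> borel_measurable M" "\<And>k. k < n \<Longrightarrow> f k = L0_class M (gs k)"
    "L0_map_n M n C f = L0_class M (\<lambda>x. C (\<lambda>k. if k < n then gs k x else 0))"
proof -
  have "\<forall>k. \<exists>g. k < n \<longrightarrow> g \<in> borel_measurable M \<and> f k = L0_class M g"
    using f by (meson L0_cases)
  then obtain gs where gs: "\<And>k. k < n \<Longrightarrow> gs k \<in> borel_measurable M" "\<And>k. k < n \<Longrightarrow> f k = L0_class M (gs k)"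
    by metis
  have "L0_map_n M n C f = L0_map_n M n C (\<lambda>k. L0_class M (gs k))"
    unfolding L0_map_n_def using gs(2) by (intro arg_cong2[of _ _ _ _ "\<lambda>I f. \<Union>(f ` I)"] Pi_cong) auto
  with gs C show thesis by (intro that[of gs]) (simp_all add: L0_map_n_class)
qed

theorem theorem2p20:
  fixes M :: "'a measure" and E :: "('a \<Rightarrow> real) set \<Rightarrow> ennreal"
  assumes "localizable M"
    and "closed_form M E"
  shows "(energy_form M E \<longleftrightarrow>
            (\<forall>C. normal_contraction_real C \<longrightarrow> (\<forall>f\<in>L0 M. E (L0_map M C f) \<le> E f)))
       \<and> (energy_form M E \<longleftrightarrow>
            (\<forall>(n :: nat) C f. normal_contraction n C \<and> (\<forall>k<n. f k \<in> L0 M) \<longrightarrow>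
               sqrt_ennreal (E (L0_map_n M n C f)) \<le> (\<Sum>k<n. sqrt_ennreal (E (f k)))))
       \<and> (energy_form M E \<longleftrightarrow>
            (\<forall>n :: nat. \<forall>f\<in>L0 M. \<forall>fs. (\<forall>k<n. fs k \<in> L0 M) \<and>
               (\<exists>g\<in>f. \<exists>gs. (\<forall>k<n. gs k \<in> fs k) \<and>
                  (\<forall>x\<in>space M. \<bar>g x\<bar> \<le> (\<Sum>k<n. \<bar>gs k x\<bar>)) \<and>
                  (\<forall>x\<in>space M. \<forall>y\<in>space M. \<bar>g x - g y\<bar> \<le> (\<Sum>k<n. \<bar>gs k x - gs k y\<bar>))) \<longrightarrow>
               sqrt_ennreal (E f) \<le> (\<Sum>k<n. sqrt_ennreal (E (fs k)))))"
    (is "(?i \<longleftrightarrow> ?ii) \<and> (?i \<longleftrightarrow> ?iii) \<and> (?i \<longleftrightarrow> ?iv)")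
proof -
  have semi: "semifinite M" using assms(1) by (simp add: localizable_def)
  have i_iv: ?iv if ?i
  proof (intro allI ballI impI, elim conjE bexE exE)
    fix n :: nat and f fs g and gs :: "nat \<Rightarrow> 'a \<Rightarrow> real"
    assume f: "f \<in> L0 M" "g \<in> f" and fs: "\<forall>k<n. fs k \<in> L0 M" "\<forall>k<n. gs k \<in> fs k"
      and val: "\<forall>x\<in>space M. \<bar>g x\<bar> \<le> (\<Sum>k<n. \<bar>gs k x\<bar>)"
      and diff: "\<forall>x\<in>space M. \<forall>y\<in>space M. \<bar>g x - g y\<bar> \<le> (\<Sum>k<n. \<bar>gs k x - gs k y\<bar>)"
    have gs: "gs k \<in> borel_measurable M" "fs k = L0_class M (gs k)" if "k < n" for k
      using L0_class_of_mem fs that by blast+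
    have "sqrt_ennreal (E (L0_class M g)) \<le> (\<Sum>k<n. sqrt_ennreal (E (L0_class M (gs k))))"
      using val diff by (intro energy_form_pointwise_domination[OF semi \<open>?i\<close>] L0_class_of_mem(1)[OF f] gs(1)) auto
    then show "sqrt_ennreal (E f) \<le> (\<Sum>k<n. sqrt_ennreal (E (fs k)))"
      using gs(2) L0_class_of_mem(2)[OF f] by simp
  qed
  \<comment> \<open>The Lipschitz bound for \<open>C\<close> gives the difference inequality, and
    its comparison with the zero sequence gives the value inequality.\<close>
  have iv_iii: ?iii if iv: ?iv
  proof (intro allI impI, elim conjE)
    fix n :: nat and C f assume C: "normal_contraction n C" and f: "\<forall>k<n. f k \<in> L0 M"
    then obtain gs where gs: "\<And>k. k < n \<Longrightarrow> gs k \<in> borel_measurable M" "\<And>k. k < n \<Longrightarrow> f k = L0_class M (gs k)"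
      and eq: "L0_map_n M n C f = L0_class M (\<lambda>x. C (\<lambda>k. if k < n then gs k x else 0))"
      using L0_map_n_cases[of n C f M] by blast
    let ?v = "\<lambda>x k. if k < n then gs k x else 0"
    have m: "(\<lambda>x. C (?v x)) \<in> borel_measurable M"
      using C gs(1) by (rule borel_measurable_normal_contraction)
    have lip: "\<bar>C y - C z\<bar> \<le> (\<Sum>k<n. \<bar>y k - z k\<bar>)" for y z
      using C by (simp add: normal_contraction_def)
    have "C (\<lambda>_. 0) = 0" using C by (simp add: normal_contraction_def)
    then have val: "\<bar>C (?v x)\<bar> \<le> (\<Sum>k<n. \<bar>gs k x\<bar>)" for x
      using lip[of "?v x" "\<lambda>_. 0"] by simp
    have diff: "\<bar>C (?v x) - C (?v y)\<bar> \<le> (\<Sum>k<n. \<bar>gs k x - gs k y\<bar>)" for x y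
      using lip[of "?v x" "?v y"] by simp
    have "\<forall>k<n. gs k \<in> f k" using gs by (simp add: L0_class_self)
    then show "sqrt_ennreal (E (L0_map_n M n C f)) \<le> (\<Sum>k<n. sqrt_ennreal (E (f k)))"
      unfolding eq using f val diff
      by (intro iv[rule_format, OF L0_class_mem[OF m]] conjI bexI[OF _ L0_class_self[OF m]] exI[of _ gs])
        simp_all
  qed
  have iii_ii: ?ii if iii: ?iii
  proof (intro allI impI ballI)
    fix C f assume C: "normal_contraction_real C" and f: "f \<in> L0 M"
    then have C1: "normal_contraction 1 (\<lambda>x. C (x 0))"
      by (simp add: normal_contraction_real_iff)
    obtain g where g: "g \<in> borel_measurable M" "f = L0_class M g" using L0_cases[OF f] .
    have "L0_map_n M 1 (\<lambda>x. C (x 0)) (\<lambda>_. f) = L0_map M C f"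
      using L0_map_n_class[OF C1, of "\<lambda>_. g" M]
        L0_map_class[OF g(1) borel_measurable_normal_contraction_real[OF C]] g by simp
    then show "E (L0_map M C f) \<le> E f"
      using iii[rule_format, of 1 "\<lambda>x. C (x 0)" "\<lambda>_. f"] C1 f by (simp add: sqrt_ennreal_mono_iff)
  qed
  have ii_i: ?i if ii: ?ii
    unfolding energy_form_def
    by (intro conjI assms(2) markovian_if_normal_contractions ii[rule_format])
  show ?thesis
  proof (intro conjI)
    show "?i \<longleftrightarrow> ?ii" by (rule iffI[OF iii_ii[OF iv_iii[OF i_iv]] ii_i])
    show "?i \<longleftrightarrow> ?iii" by (rule iffI[OF iv_iii[OF i_iv] ii_i[OF iii_ii]])
    show "?i \<longleftrightarrow> ?iv" by (rule iffI[OF i_iv ii_i[OF iii_ii[OF iv_iii]]])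
  qed
qed

end
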